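(* Let $b>1$ be an integer and let $\mathcal{A}$ be a deterministic finite automaton over $A_b=\{0,1,\ldots,b-1\}$. Then $\mathcal{A}$ belongs to the class $\mathbb{UP}$ if and only if all of the following hold, where $CG(\mathcal{A})$ denotes the component graph of $\mathcal{A}$: (UP 0) each state and its successor by the digit $0$ are both final or both non-final; (UP 1) $\mathcal{A}$ is minimal and complete; (UP 2) every type-one strongly connected component of $\mathcal{A}$ is $\mathbb{UP}$-atomic; (UP 3) every type-two strongly connected component has in $CG(\mathcal{A})$ exactly one descendant, and that descendant is a strongly connected component of type one; (UP 4) every type-two strongly connected component is embedded in its descendant in $CG(\mathcal{A})$.
   Context: Automata are deterministic and finite, written $\langle A_b,Q,i,\delta,F\rangle$ (alphabet, states, initial state, possibly partial transition function, final states); $\delta(s,u)$ is written $s\cdot u$. Automata are considered up to isomorphism. Values and acceptance. For $u=a_0a_1\cdots a_m\in A_b^*$, $\overline{u}=\sum_i a_ib^i$ (least significant digit first). An automaton accepts $S\subseteq\mathbb{N}$ if its language is $\{u\in A_b^*\mid\overline{u}\in S\}$. Periodic sets. $S\subseteq\mathbb{N}$ is purely periodic if $S=R+p\mathbb{N}$ for some integer $p\ge 1$ and $R\subseteq\{0,\ldots,p-1\}$; the least such $p$ is the period of $S$. $S$ is ultimately periodic (u.p.) if it is the symmetric difference of a finite set and a purely periodic set. The class $\mathbb{UP}$. For $S\subseteq\mathbb{N}$ and $a\in A_b$, let $\Delta(S,a)=\{n\in\mathbb{N}\mid nb+a\in S\}$, extended to words as usual. For a u.p. set $S$, $\mathcal{U}_S$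 is the automaton whose states are the sets $\Delta(S,u)$, $u\in A_b^*$ (finitely many), with initial state $S$, transition function the restriction of $\Delta$, and final states those states containing $0$; it is the minimal automaton accepting $S$. $\mathbb{UP}=\{\mathcal{U}_S\mid S\subseteq\mathbb{N}\text{ u.p.}\}$ is thus the class of all minimal automata accepting u.p. subsets of $\mathbb{N}$. A minimal automaton is the complete automaton with the least number of states accepting its language. Atomic automata. $\mathcal{U}_S$ is $\mathbb{UP}$-atomic if $S$ is purely periodic with period coprime with $b$. This property does not depend on which state is taken as initial, so a strongly connected component $C$ is called $\mathbb{UP}$-atomic if $\langle A_b,C,q,\delta_{|C},F\cap C\rangle$ is $\mathbb{UP}$-atomic for some (equivalently, any) $q\in C$. Components. Strongly connected components (s.c.c.'s) are the classes of the relation "mutually reachable". A s.c.c. is trivial if it consists of a single state lying on no circuit. A non-trivial s.c.c. is of type two if it is a simple circuit whose (internal) transitions are all labelled by $0$; it is of type one otherwise, that is, if it has an internal transition labelled by a positive digit. The component graph is the labelled directed acyclic graph obtained by contracting each s.c.c. to a vertex. A s.c.c. $X$ is a descendant of another s.c.c. $Y\neq X$ if $X$ is a successor of $Y$ in the component graph, i.e. there are $y\in Y$, $x\in X$ and a letter $a$ with $y\cdot a=x$. Embedding. A s.c.c. $C$ is embedded in another s.c.c. $D$ if there is a function $f:C\cup D\to D$ such that: (i) $f(s)=s$ for every $s\in D$; (ii) for every $s\in C$ and letter $a$, $s\cdot a$ exists if and only if $f(s)\cdot a$ exists; (iii) for every $s\in C\cup D$ and letter $a$ with $s\cdot a\in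 C\cup D$, $f(s\cdot a)=f(s)\cdot a$. *)

theory Defs
  imports Main "HOL-Library.FuncSet"
begin

text \<open>
  The base \<open>b\<close> is a parameter throughout; the digits are the natural numbers \<open>a < b\<close>, and words
  are lists of digits. A transition function is partial: \<open>None\<close> means undefined.
\<close>

record 's automaton =
  states :: "'s set"
  initial :: 's
  delta :: "'s \<Rightarrow> nat \<Rightarrow> 's option"
  finals :: "'s set"

definition dfa :: "nat \<Rightarrow> 's automaton \<Rightarrow> bool" where
  "dfa b A \<longleftrightarrow> finite (states A) \<and> initial A \<in> states A \<and> finals A \<subseteq> states A \<and>
     (\<forall>q a r. delta A q a = Some r \<longrightarrow> q \<in> states A \<and> a < b \<and> r \<in> states A)"

definition complete_automaton :: "nat \<Rightarrow> 's automaton \<Rightarrow> bool" where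
  "complete_automaton b A \<longleftrightarrow> (\<forall>q\<in>states A. \<forall>a<b. delta A q a \<noteq> None)"

definition words :: "nat \<Rightarrow> nat list set" where
  "words b = lists {..<b}"

primrec run :: "'s automaton \<Rightarrow> 's \<Rightarrow> nat list \<Rightarrow> 's option" where
  "run A q [] = Some q"
| "run A q (a # u) = Option.bind (delta A q a) (\<lambda>r. run A r u)"

definition language :: "nat \<Rightarrow> 's automaton \<Rightarrow> nat list set" where
  "language b A = {u \<in> words b. \<exists>r\<in>finals A. run A (initial A) u = Some r}"

text \<open>
  The competitors \<open>B\<close> range over automata with states in \<open>nat\<close>, since one cannot quantify over
  types; every finite automaton is isomorphic to such an automaton.
\<close>

definition minimal_automaton :: "nat \<Rightarrow> 's automaton \<Rightarrow> bool" where
  "minimal_automaton b A \<longleftrightarrow> complete_automaton b A \<and>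
     (\<forall>B :: nat automaton. dfa b B \<and> complete_automaton b B \<and> language b B = language b A
        \<longrightarrow> card (states A) \<le> card (states B))"

definition isomorphic :: "nat \<Rightarrow> 's automaton \<Rightarrow> 't automaton \<Rightarrow> bool" where
  "isomorphic b A B \<longleftrightarrow>
     (\<exists>f. bij_betw f (states A) (states B) \<and> f (initial A) = initial B \<and> f ` finals A = finals B \<and>
        (\<forall>q\<in>states A. \<forall>a<b. delta B (f q) a = map_option f (delta A q a)))"

subsection \<open>Periodic sets\<close>

definition purely_periodic_with :: "nat \<Rightarrow> nat set \<Rightarrow> bool" where
  "purely_periodic_with p S \<longleftrightarrow> p \<ge> 1 \<and> (\<exists>R\<subseteq>{..<p}. S = {r + p * k | r k. r \<in> R})"

definition purely_periodic :: "nat set \<Rightarrow> bool" where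
  "purely_periodic S \<longleftrightarrow> (\<exists>p. purely_periodic_with p S)"

definition period :: "nat set \<Rightarrow> nat" where
  "period S = (LEAST p. purely_periodic_with p S)"

definition ultimately_periodic :: "nat set \<Rightarrow> bool" where
  "ultimately_periodic S \<longleftrightarrow> (\<exists>X P. finite X \<and> purely_periodic P \<and> S = sym_diff X P)"

subsection \<open>The class UP\<close>

definition Delta :: "nat \<Rightarrow> nat set \<Rightarrow> nat \<Rightarrow> nat set" where
  "Delta b S a = {n. n * b + a \<in> S}"

definition Delta_word :: "nat \<Rightarrow> nat set \<Rightarrow> nat list \<Rightarrow> nat set" where
  "Delta_word b S u = foldl (Delta b) S u"

definition U_automaton :: "nat \<Rightarrow> nat set \<Rightarrow> nat set automaton" where
  "U_automaton b S =
     (let Q = Delta_word b S ` words b in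
      \<lparr>states = Q, initial = S,
       delta = (\<lambda>X a. if X \<in> Q \<and> a < b then Some (Delta b X a) else None),
       finals = {X \<in> Q. 0 \<in> X}\<rparr>)"

definition in_UP :: "nat \<Rightarrow> 's automaton \<Rightarrow> bool" where
  "in_UP b A \<longleftrightarrow> (\<exists>S. ultimately_periodic S \<and> isomorphic b A (U_automaton b S))"

definition UP_atomic :: "nat \<Rightarrow> 's automaton \<Rightarrow> bool" where
  "UP_atomic b A \<longleftrightarrow>
     (\<exists>S. purely_periodic S \<and> coprime (period S) b \<and> isomorphic b A (U_automaton b S))"

subsection \<open>Strongly connected components\<close>

definition reachable :: "nat \<Rightarrow> 's automaton \<Rightarrow> 's \<Rightarrow> 's \<Rightarrow> bool" where
  "reachable b A p q \<longleftrightarrow> (\<exists>u\<in>words b. run A p u = Some q)"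

definition sccs :: "nat \<Rightarrow> 's automaton \<Rightarrow> 's set set" where
  "sccs b A = states A // {(p, q). p \<in> states A \<and> q \<in> states A \<and>
                             reachable b A p q \<and> reachable b A q p}"

definition on_circuit :: "nat \<Rightarrow> 's automaton \<Rightarrow> 's \<Rightarrow> bool" where
  "on_circuit b A q \<longleftrightarrow> (\<exists>u\<in>words b. u \<noteq> [] \<and> run A q u = Some q)"

definition trivial_scc :: "nat \<Rightarrow> 's automaton \<Rightarrow> 's set \<Rightarrow> bool" where
  "trivial_scc b A C \<longleftrightarrow> C \<in> sccs b A \<and> (\<exists>q. C = {q} \<and> \<not> on_circuit b A q)"

definition internal_transitions :: "'s automaton \<Rightarrow> 's set \<Rightarrow> ('s \<times> nat \<times> 's) set" where
  "internal_transitions A C = {(p, a, q). p \<in> C \<and> q \<in> C \<and> delta A p a = Some q}"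

text \<open>
  The distinct states \<open>s 0, \<dots>, s (k - 1)\<close> enumerate the simple circuit; \<open>k = 1\<close> is a loop.
\<close>

definition type_two :: "nat \<Rightarrow> 's automaton \<Rightarrow> 's set \<Rightarrow> bool" where
  "type_two b A C \<longleftrightarrow> C \<in> sccs b A \<and> \<not> trivial_scc b A C \<and>
     (\<exists>k\<ge>1. \<exists>s :: nat \<Rightarrow> 's. inj_on s {..<k} \<and> C = s ` {..<k} \<and>
        internal_transitions A C = {(s i, 0, s (Suc i mod k)) | i. i < k})"

definition type_one :: "nat \<Rightarrow> 's automaton \<Rightarrow> 's set \<Rightarrow> bool" where
  "type_one b A C \<longleftrightarrow> C \<in> sccs b A \<and> \<not> trivial_scc b A C \<and> \<not> type_two b A C"

definition restrict_automaton :: "'s automaton \<Rightarrow> 's set \<Rightarrow> 's \<Rightarrow> 's automaton" where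
  "restrict_automaton A C q =
     \<lparr>states = C, initial = q,
      delta = (\<lambda>p a. case delta A p a of
                  None \<Rightarrow> None
                | Some r \<Rightarrow> if p \<in> C \<and> r \<in> C then Some r else None),
      finals = finals A \<inter> C\<rparr>"

definition UP_atomic_scc :: "nat \<Rightarrow> 's automaton \<Rightarrow> 's set \<Rightarrow> bool" where
  "UP_atomic_scc b A C \<longleftrightarrow>
     C \<in> sccs b A \<and> (\<exists>q\<in>C. UP_atomic b (restrict_automaton A C q))"

text \<open>The labelled edges of the component graph, whose vertices are the elements of \<open>sccs b A\<close>.\<close>

definition component_graph :: "nat \<Rightarrow> 's automaton \<Rightarrow> ('s set \<times> nat \<times> 's set) set" where
  "component_graph b A = {(Y, a, X). Y \<in> sccs b A \<and> X \<in> sccs b A \<and> Y \<noteq> X \<and> a < b \<and>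
                            (\<exists>y\<in>Y. \<exists>x\<in>X. delta A y a = Some x)}"

text \<open>Only direct successors in the component graph count as descendants.\<close>

definition descendant :: "nat \<Rightarrow> 's automaton \<Rightarrow> 's set \<Rightarrow> 's set \<Rightarrow> bool" where
  "descendant b A X Y \<longleftrightarrow> (\<exists>a. (Y, a, X) \<in> component_graph b A)"

definition embedded :: "nat \<Rightarrow> 's automaton \<Rightarrow> 's set \<Rightarrow> 's set \<Rightarrow> bool" where
  "embedded b A C D \<longleftrightarrow> C \<in> sccs b A \<and> D \<in> sccs b A \<and> C \<noteq> D \<and>
     (\<exists>f \<in> C \<union> D \<rightarrow> D.
        (\<forall>s\<in>D. f s = s) \<and>
        (\<forall>s\<in>C. \<forall>a<b. delta A s a \<noteq> None \<longleftrightarrow> delta A (f s) a \<noteq> None) \<and>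
        (\<forall>s\<in>C \<union> D. \<forall>a<b. \<forall>t\<in>C \<union> D. delta A s a = Some t \<longrightarrow> delta A (f s) a = Some (f t)))"

subsection \<open>The conditions of the characterisation\<close>

definition UP0 :: "'s automaton \<Rightarrow> bool" where
  "UP0 A \<longleftrightarrow>
     (\<forall>q\<in>states A. \<forall>r. delta A q 0 = Some r \<longrightarrow> (q \<in> finals A \<longleftrightarrow> r \<in> finals A))"

definition UP1 :: "nat \<Rightarrow> 's automaton \<Rightarrow> bool" where
  "UP1 b A \<longleftrightarrow> minimal_automaton b A \<and> complete_automaton b A"

definition UP2 :: "nat \<Rightarrow> 's automaton \<Rightarrow> bool" where
  "UP2 b A \<longleftrightarrow> (\<forall>C. type_one b A C \<longrightarrow> UP_atomic_scc b A C)"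

definition UP3 :: "nat \<Rightarrow> 's automaton \<Rightarrow> bool" where
  "UP3 b A \<longleftrightarrow>
     (\<forall>C. type_two b A C \<longrightarrow> (\<exists>D. {X. descendant b A X C} = {D} \<and> type_one b A D))"

definition UP4 :: "nat \<Rightarrow> 's automaton \<Rightarrow> bool" where
  "UP4 b A \<longleftrightarrow> (\<forall>C D. type_two b A C \<and> descendant b A D C \<longrightarrow> embedded b A C D)"

end

theory Submission
  imports Defs "HOL-Number_Theory.Cong"
begin

text \<open>
  Label each state \<open>q\<close> by the set \<open>L q\<close> of the numbers whose expansions are accepted from \<open>q\<close>;
  reading the digit \<open>a\<close> turns the label \<open>X\<close> into \<open>Delta b X a\<close>. An automaton lies in the class
  exactly if such a labelling exists, is injective and reaches every state, and the initial label
  is ultimately periodic.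

  If the labels are ultimately periodic, a circuit at \<open>q\<close> labelled by \<open>u\<close> makes \<open>L q\<close> invariant under
  \<open>n \<mapsto> n b\<^sup>k + v\<close>, where \<open>k\<close> is the length and \<open>v\<close> the value of \<open>u\<close>. For \<open>v > 0\<close> this forces
  \<open>L q\<close> to be purely periodic with period coprime to \<open>b\<close>, and on such sets the digits act as
  permutations, so the component of \<open>q\<close> is atomic. On a circuit of zeros \<open>L q\<close> becomes purely
  periodic after toggling the membership of \<open>0\<close>, and toggling is the embedding into the descendant.

  Conversely, minimality makes the labels distinct, atomic components have periodic labels, the
  label of a state on a circuit of zeros agrees with that of its image under the embedding except
  at \<open>0\<close>, and ultimate periodicity propagates backwards through the trivial components.
\<close>

section \<open>Periodic sets\<close>

definition periodic :: "nat \<Rightarrow> nat set \<Rightarrow> bool" where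
  "periodic p X \<longleftrightarrow> (\<forall>n. n + p \<in> X \<longleftrightarrow> n \<in> X)"

lemma eventually_periodic_mult:
  assumes "\<forall>n\<ge>N. n + p \<in> X \<longleftrightarrow> n \<in> (X :: nat set)" and "n \<ge> N"
  shows "n + p * j \<in> X \<longleftrightarrow> n \<in> X"
proof (induction j)
  case (Suc j)
  have "n + p * j + p \<in> X \<longleftrightarrow> n + p * j \<in> X"
    using assms by simp
  with Suc show ?case by (simp add: algebra_simps)
qed simp

lemma periodic_mult: "periodic p X \<Longrightarrow> n + p * j \<in> X \<longleftrightarrow> n \<in> X"
  using eventually_periodic_mult[of 0 p X n j] by (simp add: periodic_def)

lemma periodic_mod: "periodic p X \<Longrightarrow> n mod p \<in> X \<longleftrightarrow> n \<in> X"
  using periodic_mult[of p X "n mod p" "n div p"] by simp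

lemma periodic_cong:
  assumes "periodic p X" and "[m = n] (mod p)"
  shows "m \<in> X \<longleftrightarrow> n \<in> X"
  using periodic_mod[OF assms(1), of m] periodic_mod[OF assms(1), of n] assms(2)
  by (simp add: cong_def)

lemma purely_periodic_with_iff: "purely_periodic_with p X \<longleftrightarrow> p > 0 \<and> periodic p X"
proof
  assume "purely_periodic_with p X"
  then obtain R where p: "p > 0" and R: "R \<subseteq> {..<p}" and X: "X = {r + p * k | r k. r \<in> R}"
    by (auto simp: purely_periodic_with_def)
  have X_iff: "n \<in> X \<longleftrightarrow> n mod p \<in> R" for n
  proof
    assume "n \<in> X"
    then obtain r k where "n = r + p * k" "r \<in> R" unfolding X by blast
    then show "n mod p \<in> R" using R by auto
  next
    assume "n mod p \<in> R"
    moreover have "n = n mod p + p * (n div p)" by simp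
    ultimately show "n \<in> X" unfolding X by blast
  qed
  show "p > 0 \<and> periodic p X" using p by (auto simp: periodic_def X_iff)
next
  assume *: "p > 0 \<and> periodic p X"
  have "X = {r + p * k | r k. r \<in> X \<inter> {..<p}}"
  proof (intro equalityI subsetI)
    fix n assume "n \<in> X"
    then have "n mod p \<in> X \<inter> {..<p}" "n = n mod p + p * (n div p)"
      using * by (auto simp: periodic_mod)
    then show "n \<in> {r + p * k | r k. r \<in> X \<inter> {..<p}}" by blast
  qed (use * in \<open>auto simp: periodic_mult\<close>)
  then show "purely_periodic_with p X"
    using * unfolding purely_periodic_with_def
    by (intro conjI exI[of _ "X \<inter> {..<p}"]) auto
qed

text \<open>A \<open>p\<close>-periodic set is determined by its trace on
  \<open>{..<p}\<close>.\<close>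

lemma finite_periodic: "p > 0 \<Longrightarrow> finite {X. periodic p X}"
proof (rule finite_imageD)
  assume "p > 0"
  show "finite ((\<lambda>X. X \<inter> {..<p}) ` {X. periodic p X})"
    by (rule finite_subset[of _ "Pow {..<p}"]) auto
  show "inj_on (\<lambda>X. X \<inter> {..<p}) {X. periodic p X}"
  proof (rule inj_onI, rule set_eqI)
    fix X Y n assume XY: "X \<in> {X. periodic p X}" "Y \<in> {X. periodic p X}"
      and eq: "X \<inter> {..<p} = Y \<inter> {..<p}"
    have "n mod p \<in> X \<longleftrightarrow> n mod p \<in> Y"
      using arg_cong[OF eq, of "\<lambda>Z. n mod p \<in> Z"] \<open>p > 0\<close> by simp
    then show "n \<in> X \<longleftrightarrow> n \<in> Y" using XY by (simp add: periodic_mod)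
  qed
qed

text \<open>The remainder of \<open>p\<close> modulo the least period is again a period, hence zero.
  So the least period divides \<open>p\<close> and inherits coprimality with
  \<open>b\<close>.\<close>

lemma coprime_period:
  assumes p: "p > 0" "periodic p X" and "coprime p b"
  shows "purely_periodic X \<and> coprime (period X) b"
proof
  show pp: "purely_periodic X"
    using p unfolding purely_periodic_def purely_periodic_with_iff by blast
  let ?q = "period X"
  have q: "?q > 0" "periodic ?q X"
    using LeastI_ex[OF pp[unfolded purely_periodic_def]]
    by (simp_all add: period_def purely_periodic_with_iff)
  have least: "?q \<le> r" if "r > 0" "periodic r X" for r
    unfolding period_def by (rule Least_le) (use that in \<open>simp add: purely_periodic_with_iff\<close>)
  have "periodic (p mod ?q) X"
    unfolding periodic_def
  proof
    fix n
    have "n + p mod ?q + ?q * (p div ?q) = n + p" by simp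
    then have "n + p mod ?q \<in> X \<longleftrightarrow> n + p \<in> X"
      using periodic_mult[OF q(2), of "n + p mod ?q" "p div ?q"] by metis
    then show "n + p mod ?q \<in> X \<longleftrightarrow> n \<in> X" using p by (simp add: periodic_def)
  qed
  then have "p mod ?q = 0"
    using least[of "p mod ?q"] q(1) by (meson leD mod_less_divisor neq0_conv)
  then have "?q dvd p" by auto
  with \<open>coprime p b\<close> show "coprime ?q b" using coprime_divisors[of ?q p b b] by simp
qed

lemma ultimately_periodic_iff:
  "ultimately_periodic X \<longleftrightarrow> (\<exists>p>0. \<exists>N. \<forall>n\<ge>N. n + p \<in> X \<longleftrightarrow> n \<in> X)"
proof
  assume "ultimately_periodic X"
  then obtain F P p where F: "finite F" and P: "p > 0" "periodic p P" and X: "X = sym_diff F P"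
    unfolding ultimately_periodic_def purely_periodic_def purely_periodic_with_iff by blast
  obtain N where N: "\<forall>n\<in>F. n < N" using F finite_nat_set_iff_bounded by blast
  have "n + p \<in> X \<longleftrightarrow> n \<in> X" if "n \<ge> N" for n
    using N that P(2) unfolding X periodic_def by (metis DiffD1 DiffI Un_iff leD trans_le_add1)
  with P(1) show "\<exists>p>0. \<exists>N. \<forall>n\<ge>N. n + p \<in> X \<longleftrightarrow> n \<in> X" by blast
next
  assume "\<exists>p>0. \<exists>N. \<forall>n\<ge>N. n + p \<in> X \<longleftrightarrow> n \<in> X"
  then obtain p N where p: "p > 0" and N: "\<forall>n\<ge>N. n + p \<in> X \<longleftrightarrow> n \<in> X" by blast
  \<comment> \<open>Looking ahead by \<open>p * N\<close>, a multiple of \<open>p\<close> that is at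
    least \<open>N\<close>, continues the eventual pattern of \<open>X\<close> down to
    \<open>0\<close>.\<close>
  define P where "P = {n. n + p * N \<in> X}"
  have ge: "n + p * N \<ge> N" for n using p by (cases p) auto
  have "periodic p P"
    unfolding periodic_def
  proof
    fix n
    have "n + p + p * N = n + p * N + p" by simp
    with N ge[of n] show "n + p \<in> P \<longleftrightarrow> n \<in> P" unfolding P_def mem_Collect_eq by metis
  qed
  then have "purely_periodic P"
    using p unfolding purely_periodic_def purely_periodic_with_iff by blast
  moreover have "sym_diff X P \<subseteq> {..<N}"
  proof
    fix n assume "n \<in> sym_diff X P"
    then show "n \<in> {..<N}"
      using eventually_periodic_mult[OF N, of n N] by (cases "n < N") (auto simp: P_def)
  qed
  then have "finite (sym_diff X P)" using finite_subset by blast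
  moreover have "X = sym_diff (sym_diff X P) P" by blast
  ultimately show "ultimately_periodic X" unfolding ultimately_periodic_def by blast
qed

text \<open>Splitting off \<open>gcd p b\<close> as long as it exceeds 1 leaves a quotient
  \<open>q\<close> coprime to \<open>b\<close>. Every factor split off divides \<open>b\<close>, so
  their product \<open>d\<close> divides \<open>b ^ m\<close>, where \<open>m\<close> counts the
  splittings.\<close>

lemma factor_coprime:
  fixes p b :: nat
  assumes "p > 0"
  shows "\<exists>d q m. p = d * q \<and> coprime q b \<and> d dvd b ^ m"
  using assms
proof (induction p rule: less_induct)
  case (less p)
  show ?case
  proof (cases "coprime p b")
    case True
    then have "p = 1 * p \<and> coprime p b \<and> 1 dvd b ^ 0" by simp
    then show ?thesis by blast
  next
    case False
    let ?g = "gcd p b"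
    have "?g \<noteq> 1" "?g \<noteq> 0" using False less.prems by (auto simp: coprime_iff_gcd_eq_1)
    then have g: "?g > 1" by linarith
    have "?g dvd p" by simp
    then obtain r where r: "p = ?g * r" by (rule dvdE)
    have "r > 0" using r less.prems by (cases "r = 0") auto
    have "1 * r < ?g * r" using g \<open>r > 0\<close> by (rule mult_strict_right_mono)
    with r have "r < p" by simp
    with \<open>r > 0\<close> obtain d q m where dq: "r = d * q" "coprime q b" "d dvd b ^ m" using less.IH by blast
    have "?g * d dvd b ^ Suc m" using dq(3) by (simp add: mult_dvd_mono)
    moreover have "p = ?g * d * q" using r dq(1) by (simp add: mult.assoc)
    ultimately show ?thesis using dq(2) by blast
  qed
qed

text \<open>Iterating \<open>n \<mapsto> n b\<^sup>k + v\<close> moves \<open>n\<close> beyond the preperiod, and removes from the period all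
  factors shared with \<open>b\<close>; only \<open>n = v = 0\<close> is a fixed point.\<close>

lemma affine_invariant_periodic:
  fixes b k v :: nat
  assumes "ultimately_periodic X" and inv: "\<And>n. n * b ^ k + v \<in> X \<longleftrightarrow> n \<in> X"
    and "b > 1" and "k > 0"
  obtains q where "q > 0" "coprime q b" "\<And>n. n > 0 \<or> v > 0 \<Longrightarrow> n + q \<in> X \<longleftrightarrow> n \<in> X"
proof -
  obtain p N where p: "p > 0" and N: "\<forall>n\<ge>N. n + p \<in> X \<longleftrightarrow> n \<in> X"
    using assms(1) unfolding ultimately_periodic_iff by blast
  let ?B = "b ^ k"
  have B: "?B \<ge> 2" using \<open>b > 1\<close> \<open>k > 0\<close>
    by (metis One_nat_def Suc_leI numeral_2_eq_2 one_less_power)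
  \<comment> \<open>The \<open>j\<close>-fold iterate of the affine map has the form
    \<open>n * ?B ^ j + w\<close>, and for positive \<open>v\<close> its constant term is at least
    \<open>j\<close>.\<close>
  have iter: "\<exists>w. (v > 0 \<longrightarrow> j \<le> w) \<and> (\<forall>n. n * ?B ^ j + w \<in> X \<longleftrightarrow> n \<in> X)" for j
  proof (induction j)
    case 0
    show ?case by (intro exI[of _ 0]) auto
  next
    case (Suc j)
    then obtain w where w: "v > 0 \<longrightarrow> j \<le> w" "\<And>n. n * ?B ^ j + w \<in> X \<longleftrightarrow> n \<in> X" by blast
    have "n * ?B ^ Suc j + (w * ?B + v) \<in> X \<longleftrightarrow> n \<in> X" for n
      using inv[of "n * ?B ^ j + w"] w(2)[of n] by (simp add: algebra_simps)
    moreover have "w * 1 \<le> w * ?B" using B by (intro mult_le_mono2) linarith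
    then have "v > 0 \<longrightarrow> Suc j \<le> w * ?B + v" using w(1) by linarith
    ultimately show ?case by blast
  qed
  obtain d q m where dq: "p = d * q" "coprime q b" "d dvd b ^ m"
    using factor_coprime[OF p] by blast
  \<comment> \<open>The summand \<open>m\<close> makes \<open>d\<close> divide
    \<open>?B ^ j\<close>. The summand \<open>N\<close> moves the arguments beyond the threshold:
    through \<open>w\<close> if \<open>v > 0\<close>, and through \<open>n * ?B ^ j\<close>
    otherwise.\<close>
  define j where "j = m + N"
  obtain w where w: "v > 0 \<longrightarrow> j \<le> w" "\<And>n. n * ?B ^ j + w \<in> X \<longleftrightarrow> n \<in> X"
    using iter by blast
  have "j < 2 ^ j" by (rule less_exp)
  also have "(2 :: nat) ^ j \<le> ?B ^ j" using B by (rule power_mono) simp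
  finally have jB: "j < ?B ^ j" .
  have "m \<le> k * j" using \<open>k > 0\<close> unfolding j_def by (cases k) auto
  then have "b ^ m dvd ?B ^ j" by (simp add: le_imp_power_dvd flip: power_mult)
  then obtain t where t: "?B ^ j = d * t" using dq(3) by (meson dvdE dvd_trans)
  have "n + q \<in> X \<longleftrightarrow> n \<in> X" if "n > 0 \<or> v > 0" for n
  proof -
    have "n * ?B ^ j + w \<ge> N"
    proof (cases "v > 0")
      case True
      then show ?thesis using w(1) by (simp add: j_def)
    next
      case False
      then have "1 * ?B ^ j \<le> n * ?B ^ j" using that by (intro mult_le_mono1) simp
      moreover have "N \<le> ?B ^ j" using jB by (simp add: j_def)
      ultimately show ?thesis by linarith
    qed
    \<comment> \<open>Shifting \<open>n\<close> by \<open>q\<close> shifts the argument by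
      \<open>q * ?B ^ j = q * d * t = p * t\<close>, a multiple of \<open>p\<close>.\<close>
    from eventually_periodic_mult[OF N this, of t] dq(1) t
    have "(n + q) * ?B ^ j + w \<in> X \<longleftrightarrow> n * ?B ^ j + w \<in> X"
      by (simp add: algebra_simps)
    then show ?thesis using w(2) by simp
  qed
  moreover have "q > 0" using p dq(1) by (cases q) auto
  ultimately show ?thesis using dq(2) that by blast
qed

section \<open>The action of words on sets of numbers\<close>

abbreviation val :: "nat \<Rightarrow> nat list \<Rightarrow> nat" where
  "val b u \<equiv> horner_sum (\<lambda>a. a) b u"

lemma words_simps [simp]:
  "[] \<in> words b" "a # u \<in> words b \<longleftrightarrow> a < b \<and> u \<in> words b"
  "u @ v \<in> words b \<longleftrightarrow> u \<in> words b \<and> v \<in> words b"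
  by (auto simp: words_def)

lemma ex_word_val:
  assumes "b > 1"
  shows "\<exists>u\<in>words b. val b u = n"
proof (induction n rule: less_induct)
  case (less n)
  show ?case
  proof (cases "n = 0")
    case True
    then show ?thesis by (intro bexI[of _ "[]"]) auto
  next
    case False
    then have "n div b < n" using assms by simp
    then obtain u where "u \<in> words b" "val b u = n div b" using less.IH by blast
    then show ?thesis using assms by (intro bexI[of _ "n mod b # u"]) simp_all
  qed
qed

lemma Delta_iff [simp]: "n \<in> Delta b X a \<longleftrightarrow> n * b + a \<in> X"
  by (simp add: Delta_def)

lemma Delta_word_simps [simp]:
  "Delta_word b X [] = X" "Delta_word b X (a # u) = Delta_word b (Delta b X a) u"
  "Delta_word b X (u @ v) = Delta_word b (Delta_word b X u) v"
  by (simp_all add: Delta_word_def)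

lemma Delta_word_iff: "n \<in> Delta_word b X u \<longleftrightarrow> n * b ^ length u + val b u \<in> X"
  by (induction u arbitrary: X) (simp_all add: algebra_simps)

lemma periodic_Delta:
  assumes "periodic p X"
  shows "periodic p (Delta b X a)"
  unfolding periodic_def
proof
  fix n
  have "(n + p) * b + a = n * b + a + p * b" by (simp add: algebra_simps)
  then show "n + p \<in> Delta b X a \<longleftrightarrow> n \<in> Delta b X a"
    using periodic_mult[OF assms, of "n * b + a" b] by (simp only: Delta_iff)
qed

lemma periodic_Delta_word: "periodic p X \<Longrightarrow> periodic p (Delta_word b X u)"
  by (induction u arbitrary: X) (simp_all add: periodic_Delta)

text \<open>Since \<open>b\<close> is invertible modulo \<open>p\<close>, the numbers
  \<open>n * b + a\<close> meet every residue class modulo \<open>p\<close>, so the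
  \<open>p\<close>-periodic set \<open>X\<close> can be recovered from
  \<open>Delta b X a\<close>.\<close>

lemma inj_on_Delta:
  assumes "coprime p b" and "p > 0"
  shows "inj_on (\<lambda>X. Delta b X a) {X. periodic p X}"
proof (rule inj_onI, rule set_eqI)
  fix X Y m
  assume XY: "X \<in> {X. periodic p X}" "Y \<in> {X. periodic p X}" and eq: "Delta b X a = Delta b Y a"
  obtain x where x: "[b * x = 1] (mod p)"
    using cong_solve_coprime_nat[of b p] assms by (auto simp: coprime_commute)
  \<comment> \<open>With \<open>x\<close> inverse to \<open>b\<close>, this solves
    \<open>n * b + a = m\<close> modulo \<open>p\<close>; the term \<open>a * (p - 1)\<close> plays
    the part of \<open>-a\<close>.\<close>
  let ?n = "x * (m + a * (p - 1))"
  have "[b * x * (m + a * (p - 1)) + a = 1 * (m + a * (p - 1)) + a] (mod p)"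
    using x by (intro cong_add cong_mult cong_refl)
  moreover have "1 * (m + a * (p - 1)) + a = m + a * p"
    using \<open>p > 0\<close> by (cases p) auto
  moreover have "[m + a * p = m] (mod p)" by (simp add: cong_def)
  ultimately have "[?n * b + a = m] (mod p)"
    by (metis cong_trans mult.commute mult.left_commute)
  then have "m \<in> X \<longleftrightarrow> ?n * b + a \<in> X" "m \<in> Y \<longleftrightarrow> ?n * b + a \<in> Y"
    using XY by (auto simp: periodic_cong)
  moreover have "?n * b + a \<in> X \<longleftrightarrow> ?n * b + a \<in> Y" using eq Delta_iff by blast
  ultimately show "m \<in> X \<longleftrightarrow> m \<in> Y" by blast
qed

text \<open>Reading \<open>a\<close> is an injective self-map of the finite set of
  \<open>p\<close>-periodic sets, so the orbit of \<open>X\<close> comes back to \<open>X\<close>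
  itself. The returning word is a power of \<open>a\<close>.\<close>

lemma Delta_return:
  assumes p: "p > 0" "coprime p b" "periodic p X" and "a < b"
  shows "\<exists>w\<in>words b. Delta_word b (Delta b X a) w = X"
proof -
  let ?T = "\<lambda>X. Delta b X a" and ?P = "{X. periodic p X}"
  have iter: "Delta_word b X (replicate i a) \<in> ?P" for i
    using p(3) by (simp add: periodic_Delta_word)
  have iter_Suc: "Delta_word b X (replicate (Suc i) a) = ?T (Delta_word b X (replicate i a))" for i
    unfolding replicate_Suc by (simp flip: replicate_append_same)
  have "\<not> inj (\<lambda>i. Delta_word b X (replicate i a))"
  proof
    assume "inj (\<lambda>i. Delta_word b X (replicate i a))"
    moreover have "finite (range (\<lambda>i. Delta_word b X (replicate i a)))"
      using iter finite_periodic[OF p(1)] by (meson finite_subset image_subsetI)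
    ultimately show False using finite_imageD infinite_UNIV_nat by blast
  qed
  then obtain i j where "i < j" and eq: "Delta_word b X (replicate i a) = Delta_word b X (replicate j a)"
    unfolding inj_def by (metis linorder_neqE_nat)
  \<comment> \<open>Injectivity removes the \<open>i\<close> steps that both sides of a collision
    share.\<close>
  have cancel: "Delta_word b X (replicate k a) = X"
    if "Delta_word b X (replicate i a) = Delta_word b X (replicate (i + k) a)" for i k
    using that
  proof (induction i)
    case (Suc i)
    then show ?case
      using inj_on_Delta[OF p(2,1), of a] iter[of i] iter[of "i + k"]
      unfolding add_Suc iter_Suc by (auto dest: inj_onD)
  qed simp
  have "Delta_word b X (replicate (j - i) a) = X"
    using cancel[of i "j - i"] eq \<open>i < j\<close> by simp
  moreover obtain k where "j - i = Suc k" using \<open>i < j\<close> by (metis Suc_diff_Suc)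
  ultimately have "Delta_word b (Delta b X a) (replicate k a) = X" by simp
  moreover have "replicate k a \<in> words b" using \<open>a < b\<close> by (auto simp: words_def)
  ultimately show ?thesis by blast
qed

lemma Delta_word_return:
  assumes "p > 0" "coprime p b" "periodic p X" and "u \<in> words b"
  shows "\<exists>w\<in>words b. Delta_word b (Delta_word b X u) w = X"
  using assms(3,4)
proof (induction u arbitrary: X)
  case Nil
  then show ?case by (intro bexI[of _ "[]"]) auto
next
  case (Cons a u)
  then obtain w where w: "w \<in> words b" "Delta_word b (Delta_word b (Delta b X a) u) w = Delta b X a"
    using periodic_Delta by fastforce
  obtain w' where w': "w' \<in> words b" "Delta_word b (Delta b X a) w' = X"
    using Delta_return[OF assms(1,2) Cons.prems(1)] Cons.prems(2) by auto
  show ?case by (rule bexI[of _ "w @ w'"]) (use w w' in simp_all)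
qed

section \<open>Runs and strongly connected components\<close>

lemma run_append: "run A q (u @ v) = Option.bind (run A q u) (\<lambda>r. run A r v)"
  by (induction u arbitrary: q) simp_all

lemma reachable_refl [simp]: "reachable b A q q"
  unfolding reachable_def by (rule bexI[of _ "[]"]) auto

lemma reachable_trans: "reachable b A p q \<Longrightarrow> reachable b A q r \<Longrightarrow> reachable b A p r"
proof -
  assume "reachable b A p q" "reachable b A q r"
  then obtain u v where uv: "u \<in> words b" "run A p u = Some q" "v \<in> words b" "run A q v = Some r"
    unfolding reachable_def by blast
  then show ?thesis
    unfolding reachable_def by (intro bexI[of _ "u @ v"]) (simp_all add: run_append)
qed

lemma reachable_delta: "delta A q a = Some r \<Longrightarrow> a < b \<Longrightarrow> reachable b A q r"
  unfolding reachable_def by (rule bexI[of _ "[a]"]) auto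

definition scc_of :: "nat \<Rightarrow> 's automaton \<Rightarrow> 's \<Rightarrow> 's set" where
  "scc_of b A q = {r \<in> states A. reachable b A q r \<and> reachable b A r q}"

lemma self_in_scc_of: "q \<in> states A \<Longrightarrow> q \<in> scc_of b A q"
  by (simp add: scc_of_def)

lemma scc_of_in_sccs: "q \<in> states A \<Longrightarrow> scc_of b A q \<in> sccs b A"
  unfolding sccs_def quotient_def scc_of_def by auto

lemma scc_of_eqI:
  assumes "reachable b A q r" "reachable b A r q"
  shows "scc_of b A r = scc_of b A q"
proof (rule set_eqI)
  fix p
  show "p \<in> scc_of b A r \<longleftrightarrow> p \<in> scc_of b A q"
    unfolding scc_of_def using reachable_trans[OF assms(1), of p] reachable_trans[OF assms(2), of p]
      reachable_trans[OF _ assms(1), of p] reachable_trans[OF _ assms(2), of p] by blast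
qed

lemma sccsD:
  assumes "C \<in> sccs b A" "q \<in> C"
  shows "q \<in> states A" "C = scc_of b A q"
proof -
  obtain p where "p \<in> states A" "C = scc_of b A p"
    using assms(1) unfolding sccs_def by (rule quotientE) (auto simp: scc_of_def)
  then show "q \<in> states A" "C = scc_of b A q"
    using assms(2) scc_of_eqI[of b A p q] by (simp_all add: scc_of_def)
qed

lemma sccs_subset: "C \<in> sccs b A \<Longrightarrow> C \<subseteq> states A"
  using sccsD(1)[of C b A] by (intro subsetI)

lemma sccs_reachable: "C \<in> sccs b A \<Longrightarrow> p \<in> C \<Longrightarrow> q \<in> C \<Longrightarrow> reachable b A p q"
  using sccsD(2)[of C b A p] by (auto simp: scc_of_def)

lemma sccs_memI:
  assumes "C \<in> sccs b A" "p \<in> C" "r \<in> states A" "reachable b A p r" "reachable b A r p"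
  shows "r \<in> C"
  using sccsD(2)[OF assms(1,2)] assms(3-5) by (simp add: scc_of_def)

lemma sccs_nonempty: "C \<in> sccs b A \<Longrightarrow> C \<noteq> {}"
  unfolding sccs_def by (auto elim!: quotientE)

lemma nontrivial_on_circuit:
  assumes "C \<in> sccs b A" "\<not> trivial_scc b A C" "q \<in> C"
  shows "on_circuit b A q"
proof (cases "C = {q}")
  case True
  then show ?thesis using assms by (auto simp: trivial_scc_def)
next
  case False
  then obtain r where r: "r \<in> C" "r \<noteq> q" using assms(3) by blast
  then have "reachable b A q r" "reachable b A r q"
    using sccs_reachable[OF assms(1)] assms(3) by auto
  then obtain u v where uv: "u \<in> words b" "run A q u = Some r" "v \<in> words b" "run A r v = Some q"
    unfolding reachable_def by blast
  then have "u \<noteq> []" using r(2) by auto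
  then show ?thesis unfolding on_circuit_def
    by (intro bexI[of _ "u @ v"]) (use uv in \<open>auto simp: run_append\<close>)
qed

section \<open>Labelling states by sets of numbers\<close>

text \<open>Completeness is contained in \<open>step\<close>; together with \<open>final_iff\<close>
  it forces \<open>L q\<close> to be the set of values accepted from \<open>q\<close>. Injectivity
  of \<open>L\<close> and reachability are left out, so that the locale also covers automata for
  which they are yet to be derived.\<close>

locale labelled_dfa =
  fixes b :: nat and A :: "'s automaton" and L :: "'s \<Rightarrow> nat set"
  assumes base: "b > 1" and dfa: "dfa b A"
    and step: "\<And>q a. q \<in> states A \<Longrightarrow> a < b \<Longrightarrow> \<exists>r. delta A q a = Some r \<and> L r = Delta b (L q) a"
    and final_iff: "\<And>q. q \<in> states A \<Longrightarrow> q \<in> finals A \<longleftrightarrow> 0 \<in> L q"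
begin

lemma complete: "complete_automaton b A"
  using step by (fastforce simp: complete_automaton_def)

lemma deltaD:
  assumes "delta A q a = Some r"
  shows "q \<in> states A" "a < b" "r \<in> states A" "L r = Delta b (L q) a"
proof -
  show *: "q \<in> states A" "a < b" "r \<in> states A" using dfa assms unfolding dfa_def by blast+
  show "L r = Delta b (L q) a" using step[OF *(1,2)] assms by auto
qed

lemma initial_state: "initial A \<in> states A"
  using dfa by (simp add: dfa_def)

lemma runD:
  assumes "run A q u = Some r" "q \<in> states A"
  shows "r \<in> states A \<and> u \<in> words b \<and> L r = Delta_word b (L q) u"
  using assms
proof (induction u arbitrary: q)
  case (Cons a u)
  then obtain p where p: "delta A q a = Some p" "run A p u = Some r"
    by (auto simp: bind_eq_Some_conv)
  then show ?case using Cons.IH[OF p(2)] deltaD[OF p(1)] by simp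
qed simp

lemma run_ex: "q \<in> states A \<Longrightarrow> u \<in> words b \<Longrightarrow> \<exists>r. run A q u = Some r"
proof (induction u arbitrary: q)
  case (Cons a u)
  then obtain p where "delta A q a = Some p" using step by fastforce
  then show ?case using Cons deltaD(3) by simp
qed simp

lemma accept_iff:
  assumes "run A q u = Some r" "q \<in> states A"
  shows "r \<in> finals A \<longleftrightarrow> val b u \<in> L q"
  using runD[OF assms] final_iff[of r] by (simp add: Delta_word_iff)

lemma language_eq: "language b A = {u \<in> words b. val b u \<in> L (initial A)}"
proof -
  have "(\<exists>r\<in>finals A. run A (initial A) u = Some r) \<longleftrightarrow> val b u \<in> L (initial A)"
    if "u \<in> words b" for u
    using run_ex[OF initial_state that] accept_iff[OF _ initial_state, of u] by auto
  then show ?thesis unfolding language_def by blast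
qed

lemma mem_label_iff:
  assumes "q \<in> states A" "delta A q (n mod b) = Some r"
  shows "n \<in> L q \<longleftrightarrow> n div b \<in> L r"
  using deltaD(4)[OF assms(2)] by simp

lemma reachableD:
  assumes "reachable b A q r" "q \<in> states A"
  shows "r \<in> states A"
  using assms runD unfolding reachable_def by blast

text \<open>The right-hand side is the state set of \<open>U_automaton b (L q)\<close>, so this
  links the states of \<open>A\<close> with the states of that automaton.\<close>

lemma label_image:
  "L ` {r. reachable b A q r} = Delta_word b (L q) ` words b" if q: "q \<in> states A"
proof (intro equalityI subsetI)
  fix X assume "X \<in> L ` {r. reachable b A q r}"
  then obtain r u where "X = L r" "u \<in> words b" "run A q u = Some r"
    by (auto simp: reachable_def)
  then show "X \<in> Delta_word b (L q) ` words b" using runD[OF _ q] by blast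
next
  fix X assume "X \<in> Delta_word b (L q) ` words b"
  then obtain u where u: "u \<in> words b" "X = Delta_word b (L q) u" by blast
  then obtain r where "run A q u = Some r" using run_ex[OF q] by blast
  then show "X \<in> L ` {r. reachable b A q r}"
    using u runD[OF _ q] by (intro image_eqI[of _ _ r]) (auto simp: reachable_def)
qed

text \<open>The labelling itself is the isomorphism; reachability of all states makes it
  surjective.\<close>

lemma isomorphic_U_automaton:
  assumes inj: "inj_on L (states A)" and reach: "\<And>q. q \<in> states A \<Longrightarrow> reachable b A (initial A) q"
  shows "isomorphic b A (U_automaton b (L (initial A)))"
proof -
  have "{r. reachable b A (initial A) r} = states A"
    using reach reachableD[OF _ initial_state] by blast
  then have img: "L ` states A = Delta_word b (L (initial A)) ` words b"
    using label_image[OF initial_state] by simp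
  have "L ` finals A = {X \<in> L ` states A. 0 \<in> X}"
    using final_iff dfa unfolding dfa_def by auto
  moreover have "Some (Delta b (L q) a) = map_option L (delta A q a)" if "q \<in> states A" "a < b" for q a
    using step[OF that] by fastforce
  ultimately show ?thesis
    unfolding isomorphic_def U_automaton_def Let_def
    by (intro exI[of _ L]) (auto simp: inj bij_betw_def simp flip: img)
qed

text \<open>Some word carries the label of \<open>r\<close> back to that of \<open>q\<close>, and
  injectivity turns the equality of labels into an equality of states.\<close>

lemma reachable_back:
  assumes inj: "inj_on L (states A)" and p: "p > 0" "coprime p b" "periodic p (L q)"
    and qr: "q \<in> states A" "reachable b A q r"
  shows "reachable b A r q"
proof -
  obtain u where u: "u \<in> words b" "run A q u = Some r" using qr by (auto simp: reachable_def)
  have r: "r \<in> states A" "L r = Delta_word b (L q) u" using runD[OF u(2) qr(1)] by auto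
  obtain w where w: "w \<in> words b" "Delta_word b (L r) w = L q"
    using Delta_word_return[OF p u(1)] r(2) by auto
  obtain t where t: "run A r w = Some t" using run_ex[OF r(1) w(1)] by blast
  then have "t = q" using runD[OF t r(1)] w(2) inj qr(1) by (auto dest: inj_onD)
  then show ?thesis using t w(1) by (auto simp: reachable_def)
qed

end

text \<open>The states of \<open>U_automaton\<close> are sets of numbers, so the isomorphism is
  itself a labelling.\<close>

lemma isomorphic_U_automatonD:
  assumes "b > 1" and "dfa b A" and iso: "isomorphic b A (U_automaton b S)"
  obtains L where "labelled_dfa b A L" "inj_on L (states A)" "L (initial A) = S"
    "\<And>q. q \<in> states A \<Longrightarrow> reachable b A (initial A) q"
proof -
  let ?Q = "Delta_word b S ` words b"
  obtain L where bij: "bij_betw L (states A) ?Q" and init: "L (initial A) = S"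
    and fin: "L ` finals A = {X \<in> ?Q. 0 \<in> X}"
    and del: "\<And>q a. q \<in> states A \<Longrightarrow> a < b \<Longrightarrow>
      (if L q \<in> ?Q \<and> a < b then Some (Delta b (L q) a) else None) = map_option L (delta A q a)"
    using iso unfolding isomorphic_def U_automaton_def Let_def by auto
  have inj: "inj_on L (states A)" and img: "L ` states A = ?Q"
    using bij by (auto simp: bij_betw_def)
  have lab: "labelled_dfa b A L"
  proof
    fix q a assume q: "q \<in> states A" "a < b"
    then have "L q \<in> ?Q" using img by blast
    then have "map_option L (delta A q a) = Some (Delta b (L q) a)" using del[OF q] q(2) by simp
    then show "\<exists>r. delta A q a = Some r \<and> L r = Delta b (L q) a" by (cases "delta A q a") auto
  next
    fix q assume q: "q \<in> states A"
    have "finals A \<subseteq> states A" using \<open>dfa b A\<close> by (simp add: dfa_def)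
    then have "q \<in> finals A \<longleftrightarrow> L q \<in> L ` finals A" using inj_on_image_mem_iff[OF inj q] by simp
    moreover have "L q \<in> ?Q" using img q by blast
    ultimately show "q \<in> finals A \<longleftrightarrow> 0 \<in> L q" unfolding fin by simp
  qed fact+
  interpret labelled_dfa b A L by fact
  have "reachable b A (initial A) q" if q: "q \<in> states A" for q
  proof -
    have "L q \<in> ?Q" using img q by blast
    also have "?Q = L ` {r. reachable b A (initial A) r}"
      using label_image[OF initial_state] init by simp
    finally
    obtain r where r: "reachable b A (initial A) r" "L r = L q" by auto
    then have "r = q" using inj q reachableD[OF r(1) initial_state] by (auto dest: inj_onD)
    then show ?thesis using r by simp
  qed
  with lab inj init show ?thesis using that by blast
qed

section \<open>Minimality and distinct labels\<close>

context labelled_dfa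
begin

text \<open>The Myhill-Nerode argument: send \<open>q\<close> to the state \<open>g q\<close> that
  \<open>B\<close> reaches by an access word \<open>w q\<close> of \<open>q\<close>. The label of
  \<open>q\<close> can be read off from the words accepted from \<open>g q\<close>, so
  \<open>g\<close> is injective.\<close>

lemma minimal:
  assumes inj: "inj_on L (states A)" and reach: "\<And>q. q \<in> states A \<Longrightarrow> reachable b A (initial A) q"
  shows "minimal_automaton b A"
  unfolding minimal_automaton_def
proof (intro conjI allI impI complete)
  fix B :: "nat automaton"
  assume *: "dfa b B \<and> complete_automaton b B \<and> language b B = language b A"
  have B_run: "\<exists>r\<in>states B. run B q u = Some r" if "q \<in> states B" "u \<in> words b" for q u
    using that
  proof (induction u arbitrary: q)
    case (Cons a u)
    then obtain p where p: "delta B q a = Some p" using * by (fastforce simp: complete_automaton_def)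
    then have "p \<in> states B" using * unfolding dfa_def by blast
    then show ?case using Cons p by simp
  qed simp
  have initB: "initial B \<in> states B" using * by (simp add: dfa_def)
  obtain w where w: "\<And>q. q \<in> states A \<Longrightarrow> w q \<in> words b \<and> run A (initial A) (w q) = Some q"
    using reach unfolding reachable_def by metis
  define g where "g q = the (run B (initial B) (w q))" for q
  have g: "run B (initial B) (w q) = Some (g q)" "g q \<in> states B" if "q \<in> states A" for q
    using B_run[OF initB, of "w q"] w[OF that] by (auto simp: g_def)
  have label_iff: "n \<in> L q \<longleftrightarrow> (\<exists>r\<in>finals B. run B (g q) u = Some r)"
    if q: "q \<in> states A" and u: "u \<in> words b" "val b u = n" for q u n
  proof -
    obtain r where r: "run A q u = Some r" using run_ex[OF q u(1)] by blast
    have "n \<in> L q \<longleftrightarrow> r \<in> finals A" using accept_iff[OF r q] u by simp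
    also have "\<dots> \<longleftrightarrow> w q @ u \<in> language b A"
      using w[OF q] r u(1) by (auto simp: language_def run_append)
    also have "\<dots> \<longleftrightarrow> w q @ u \<in> language b B" using * by simp
    also have "\<dots> \<longleftrightarrow> (\<exists>r\<in>finals B. run B (g q) u = Some r)"
      using w[OF q] g[OF q] u(1) by (simp add: language_def run_append)
    finally show ?thesis .
  qed
  have "inj_on g (states A)"
  proof (rule inj_onI)
    fix q q' assume q: "q \<in> states A" "q' \<in> states A" "g q = g q'"
    have "n \<in> L q \<longleftrightarrow> n \<in> L q'" for n
    proof -
      obtain u where "u \<in> words b" "val b u = n" using ex_word_val[OF base] by blast
      then show ?thesis using label_iff q by metis
    qed
    then have "L q = L q'" by blast
    then show "q = q'" using inj q by (auto dest: inj_onD)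
  qed
  moreover have "g ` states A \<subseteq> states B" using g(2) by blast
  moreover have "finite (states B)" using * by (simp add: dfa_def)
  ultimately show "card (states A) \<le> card (states B)" by (rule card_inj_on_le)
qed

text \<open>The labels of the reachable states form a complete automaton for the same language.
  Minimality bounds the number of states by the number of these labels, which is at most the number
  of reachable states; so all states are reachable and no two share a label.\<close>

lemma minimalD:
  assumes min: "minimal_automaton b A"
  shows "inj_on L (states A)" "\<And>q. q \<in> states A \<Longrightarrow> reachable b A (initial A) q"
proof -
  let ?R = "{r. reachable b A (initial A) r}"
  have fin: "finite (states A)" using dfa by (simp add: dfa_def)
  have R: "?R \<subseteq> states A" using reachableD[OF _ initial_state] by blast
  then have finR: "finite ?R" using fin finite_subset by blast
  let ?n = "card (L ` ?R)"
  obtain g where g: "bij_betw g {0..<?n} (L ` ?R)"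
    using ex_bij_betw_nat_finite[of "L ` ?R"] finR by auto
  then have g_img: "g ` {0..<?n} = L ` ?R" and g_inj: "inj_on g {0..<?n}"
    by (auto simp: bij_betw_def)
  let ?h = "inv_into {0..<?n} g"
  have h: "?h X < ?n" "g (?h X) = X" if "X \<in> L ` ?R" for X
    using that inv_into_into[of X g "{0..<?n}"] f_inv_into_f[of X g "{0..<?n}"]
    unfolding g_img by auto
  have closed: "Delta b X a \<in> L ` ?R" if X: "X \<in> L ` ?R" and "a < b" for X a
  proof -
    obtain r where r: "X = L r" "reachable b A (initial A) r" using X by auto
    then obtain t where t: "delta A r a = Some t" "L t = Delta b (L r) a"
      using step[OF _ \<open>a < b\<close>] R by blast
    then have "reachable b A (initial A) t"
      using r(2) reachable_delta[OF t(1) \<open>a < b\<close>] reachable_trans by metis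
    then show ?thesis using t(2) r(1) by (intro image_eqI[of _ _ t]) auto
  qed
  have gR: "g i \<in> L ` ?R" if "i < ?n" for i
    using bij_betw_apply[OF g, of i] that by simp
  \<comment> \<open>Competitors in \<open>minimal_automaton\<close> have states in
    \<open>nat\<close>, so the labels are numbered by \<open>?h\<close>, with \<open>g\<close> as
    its inverse.\<close>
  define B :: "nat automaton" where "B = \<lparr>states = {0..<?n}, initial = ?h (L (initial A)),
    delta = \<lambda>i a. if i < ?n \<and> a < b then Some (?h (Delta b (g i) a)) else None,
    finals = {i. i < ?n \<and> 0 \<in> g i}\<rparr>"
  have init: "L (initial A) \<in> L ` ?R" by auto
  have dfaB: "dfa b B"
    using h(1) closed gR init unfolding dfa_def B_def by (auto split: if_splits)
  interpret B: labelled_dfa b B g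
  proof (unfold_locales; (fact base dfaB)?)
    fix q a assume "q \<in> states B" "a < b"
    then show "\<exists>r. delta B q a = Some r \<and> g r = Delta b (g q) a"
      using h(2)[OF closed[OF gR]] by (simp add: B_def)
  qed (simp add: B_def)
  have "language b B = language b A"
    unfolding B.language_eq language_eq using h(2)[OF init] by (simp add: B_def)
  then have "card (states A) \<le> card (states B)"
    using min B.dfa B.complete unfolding minimal_automaton_def by blast
  then have le: "card (states A) \<le> card (L ` ?R)" by (simp add: B_def)
  also have "\<dots> \<le> card ?R" using finR by (rule card_image_le)
  finally have R_eq: "?R = states A" using R fin by (simp add: card_seteq)
  then show "\<And>q. q \<in> states A \<Longrightarrow> reachable b A (initial A) q" by blast
  show "inj_on L (states A)"
    using le R_eq fin card_image_le[OF fin, of L] by (intro eq_card_imp_inj_on) auto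
qed

end

section \<open>Restriction to a component\<close>

lemma dfa_restrict:
  assumes "dfa b A" "C \<subseteq> states A" "q \<in> C"
  shows "dfa b (restrict_automaton A C q)"
  using assms unfolding dfa_def restrict_automaton_def
  by (auto split: option.splits if_splits intro: finite_subset)

lemma delta_restrict:
  "delta (restrict_automaton A C q) p a = Some r \<longleftrightarrow> delta A p a = Some r \<and> p \<in> C \<and> r \<in> C"
  by (auto simp: restrict_automaton_def split: option.splits)

text \<open>Induction on the number: its lowest digit leads to a state inside \<open>C\<close>,
  because the restricted automaton is complete, and to the smaller number \<open>n div b\<close>. At
  \<open>0\<close> both labels record finality.\<close>

lemma label_restrict_eq:
  assumes A: "labelled_dfa b A L" and R: "labelled_dfa b (restrict_automaton A C p) L'"
    and C: "C \<subseteq> states A" and "q \<in> C"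
  shows "L' q = L q"
proof -
  interpret A: labelled_dfa b A L by fact
  interpret R: labelled_dfa b "restrict_automaton A C p" L' by fact
  have states: "states (restrict_automaton A C p) = C" "finals (restrict_automaton A C p) = finals A \<inter> C"
    by (simp_all add: restrict_automaton_def)
  have "n \<in> L' q \<longleftrightarrow> n \<in> L q" for n
    using \<open>q \<in> C\<close>
  proof (induction n arbitrary: q rule: less_induct)
    case (less n)
    show ?case
    proof (cases "n = 0")
      case True
      then show ?thesis using A.final_iff[of q] R.final_iff[of q] less.prems C states by auto
    next
      case False
      have "n mod b < b" using A.base by simp
      then obtain r where r: "delta (restrict_automaton A C p) q (n mod b) = Some r"
        using R.step[of q] less.prems states by blast
      then have r': "delta A q (n mod b) = Some r" "r \<in> C" by (auto simp: delta_restrict)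
      have "n div b < n" using False A.base by simp
      then show ?thesis
        using less.IH[OF _ r'(2), of "n div b"] R.mem_label_iff[OF _ r] A.mem_label_iff[OF _ r'(1)]
          less.prems C states by auto
    qed
  qed
  then show ?thesis by blast
qed

section \<open>Sufficiency of the conditions\<close>

text \<open>The sets \<open>Delta b X a\<close> are the slices of \<open>X\<close> along the residue
  classes modulo \<open>b\<close>. A common period \<open>p\<close> of the slices gives the period
  \<open>p * b\<close> of \<open>X\<close>.\<close>

lemma ultimately_periodic_Delta_cover:
  assumes "b > 0" and "\<And>a. a < b \<Longrightarrow> ultimately_periodic (Delta b X a)"
  shows "ultimately_periodic X"
proof -
  obtain P N where P: "\<And>a. a < b \<Longrightarrow> P a > 0"
    and N: "\<And>a. a < b \<Longrightarrow> \<forall>n\<ge>N a. n + P a \<in> Delta b X a \<longleftrightarrow> n \<in> Delta b X a"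
    using assms(2) unfolding ultimately_periodic_iff by metis
  define p where "p = (\<Prod>a<b. P a)"
  have "n + p * b \<in> X \<longleftrightarrow> n \<in> X" if "n \<ge> b * (\<Sum>a<b. N a)" for n
  proof -
    let ?a = "n mod b" and ?m = "n div b"
    have a: "?a < b" using \<open>b > 0\<close> by simp
    have "N ?a \<le> (\<Sum>a<b. N a)" using a by (intro member_le_sum) auto
    also have "\<dots> \<le> ?m" using that \<open>b > 0\<close> by (simp add: less_eq_div_iff_mult_less_eq mult.commute)
    finally have m: "N ?a \<le> ?m" .
    have "P ?a dvd p" unfolding p_def using a by (intro dvd_prodI) auto
    then obtain t where "p = P ?a * t" by (rule dvdE)
    then have "?m + p \<in> Delta b X ?a \<longleftrightarrow> ?m \<in> Delta b X ?a"
      using eventually_periodic_mult[OF N[OF a] m] by simp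
    moreover have "(?m + p) * b + ?a = n + p * b" by (simp add: algebra_simps)
    ultimately show ?thesis by simp
  qed
  moreover have "p * b > 0" using P \<open>b > 0\<close> by (simp add: p_def prod_pos)
  ultimately show ?thesis unfolding ultimately_periodic_iff by blast
qed

context labelled_dfa
begin

text \<open>The isomorphism of the atomic component with a \<open>U_automaton\<close> labels its
  states by periodic sets, and these labels agree with \<open>L\<close>.\<close>

lemma type_one_periodic:
  assumes "UP2 b A" "type_one b A C" "q \<in> C"
  shows "\<exists>p>0. periodic p (L q)"
proof -
  have C: "C \<in> sccs b A" using assms(2) by (simp add: type_one_def)
  then have sub: "C \<subseteq> states A" by (rule sccs_subset)
  have "UP_atomic_scc b A C" using assms(1,2) by (simp add: UP2_def)
  then obtain q0 S where q0: "q0 \<in> C" and S: "purely_periodic S"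
    and iso: "isomorphic b (restrict_automaton A C q0) (U_automaton b S)"
    unfolding UP_atomic_scc_def UP_atomic_def by (elim conjE bexE exE) (rule that)
  obtain L' where L': "labelled_dfa b (restrict_automaton A C q0) L'"
    and init: "L' (initial (restrict_automaton A C q0)) = S"
    and reach: "\<And>q. q \<in> states (restrict_automaton A C q0) \<Longrightarrow>
      reachable b (restrict_automaton A C q0) (initial (restrict_automaton A C q0)) q"
    by (rule isomorphic_U_automatonD[OF base dfa_restrict[OF dfa sub q0] iso]) (rule that)
  interpret R: labelled_dfa b "restrict_automaton A C q0" L' by fact
  have "q \<in> states (restrict_automaton A C q0)" using assms(3) by (simp add: restrict_automaton_def)
  from reach[OF this] obtain u
    where "run (restrict_automaton A C q0) (initial (restrict_automaton A C q0)) u = Some q"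
    unfolding reachable_def by blast
  then have "L' q = Delta_word b S u" using R.runD[OF _ R.initial_state] init by simp
  moreover obtain p where "p > 0" "periodic p S"
    using S by (auto simp: purely_periodic_def purely_periodic_with_iff)
  ultimately have "p > 0" "periodic p (L' q)" by (simp_all add: periodic_Delta_word)
  then show ?thesis
    using label_restrict_eq[OF labelled_dfa_axioms L' sub assms(3)] by auto
qed

text \<open>Reading a positive number from \<open>q\<close> and from \<open>f q\<close>, the two
  runs are related by \<open>f\<close> while the first stays in \<open>C\<close>, and coincide once
  it enters \<open>D\<close>, where \<open>f\<close> is the identity. The number \<open>0\<close> is
  excluded because an embedding does not compare finality.\<close>

lemma type_two_label:
  assumes "UP3 b A" "UP4 b A" and two: "type_two b A C" and "q \<in> C"
  shows "\<exists>D r. type_one b A D \<and> r \<in> D \<and> (\<forall>n>0. n \<in> L q \<longleftrightarrow> n \<in> L r)"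
proof -
  have C: "C \<in> sccs b A" using two by (simp add: type_two_def)
  obtain D where D: "{X. descendant b A X C} = {D}" "type_one b A D"
    using assms(1)[unfolded UP3_def, rule_format, OF two] by blast
  have D_scc: "D \<in> sccs b A" using D(2) by (simp add: type_one_def)
  have "descendant b A D C" using D(1) by blast
  then have "embedded b A C D" using assms(2) two by (simp add: UP4_def)
  then obtain f where f: "f \<in> C \<union> D \<rightarrow> D" "\<forall>s\<in>D. f s = s"
    and hom: "\<forall>s\<in>C \<union> D. \<forall>a<b. \<forall>t\<in>C \<union> D. delta A s a = Some t \<longrightarrow> delta A (f s) a = Some (f t)"
    unfolding embedded_def by (elim conjE bexE) (rule that)
  have eq: "n \<in> L q \<longleftrightarrow> n \<in> L (f q)" if "n > 0" "q \<in> C" for n q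
    using that
  proof (induction n arbitrary: q rule: less_induct)
    case (less n)
    let ?a = "n mod b"
    have a: "?a < b" using base by simp
    have q: "q \<in> states A" using sccsD(1)[OF C less.prems(2)] .
    obtain t where t: "delta A q ?a = Some t" using step[OF q a] by blast
    have fq: "f q \<in> states A" using f(1) less.prems(2) sccsD(1)[OF D_scc] by blast
    show ?case
    proof (cases "t \<in> C")
      case True
      have ft: "delta A (f q) ?a = Some (f t)" using hom t a less.prems True by blast
      have "(q, ?a, t) \<in> internal_transitions A C"
        using less.prems True t by (simp add: internal_transitions_def)
      \<comment> \<open>As the digit read inside \<open>C\<close> is \<open>0\<close>, the quotient
        \<open>n div b\<close> is still positive and the induction hypothesis applies to it.\<close>
      then have "?a = 0" using two unfolding type_two_def by auto
      then have "n div b > 0" using less.prems(1) base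
        by (simp add: div_greater_zero_iff mod_eq_0_iff_dvd dvd_imp_le)
      moreover have "n div b < n" using less.prems(1) base by simp
      ultimately have "n div b \<in> L t \<longleftrightarrow> n div b \<in> L (f t)" using less.IH True by blast
      then show ?thesis using mem_label_iff[OF q t] mem_label_iff[OF fq ft] by simp
    next
      case False
      have t_state: "t \<in> states A" using deltaD(3)[OF t] .
      then have "scc_of b A t \<noteq> C" using self_in_scc_of[OF t_state] False by auto
      then have "(C, ?a, scc_of b A t) \<in> component_graph b A"
        using C scc_of_in_sccs[OF t_state] a less.prems(2) t self_in_scc_of[OF t_state]
        by (auto simp: component_graph_def)
      then have "scc_of b A t \<in> {X. descendant b A X C}" by (auto simp: descendant_def)
      then have tD: "t \<in> D" using D(1) self_in_scc_of[OF t_state] by auto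
      then have "delta A (f q) ?a = Some t" using hom[rule_format, OF _ a _ t] f(2) less.prems(2) by simp
      then show ?thesis using mem_label_iff[OF q t] mem_label_iff[OF fq] by simp
    qed
  qed
  have "f q \<in> D" using f(1) \<open>q \<in> C\<close> by blast
  with eq \<open>q \<in> C\<close> D(2) show ?thesis by blast
qed

text \<open>Induction on the number of reachable states. A state in a trivial component is not
  reachable from its successors, so these reach strictly fewer states.\<close>

lemma ultimately_periodic_label:
  assumes "UP2 b A" "UP3 b A" "UP4 b A" and "q \<in> states A"
  shows "ultimately_periodic (L q)"
  using assms(4)
proof (induction "card {r. reachable b A q r}" arbitrary: q rule: less_induct)
  case less
  note q = less.prems
  let ?C = "scc_of b A q"
  have C: "?C \<in> sccs b A" "q \<in> ?C" using scc_of_in_sccs[OF q] self_in_scc_of[OF q] by auto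
  consider "trivial_scc b A ?C" | "type_two b A ?C" | "type_one b A ?C"
    using C(1) unfolding type_one_def by blast
  then show ?case
  proof cases
    case 1
    then have not_circuit: "\<not> on_circuit b A q" using C(2) by (auto simp: trivial_scc_def)
    show ?thesis
    proof (rule ultimately_periodic_Delta_cover)
      show "b > 0" using base by simp
      fix a assume a: "a < b"
      obtain t where t: "delta A q a = Some t" "L t = Delta b (L q) a" using step[OF q a] by blast
      have "\<not> reachable b A t q"
      proof
        assume "reachable b A t q"
        then obtain u where "u \<in> words b" "run A t u = Some q" by (auto simp: reachable_def)
        then have "a # u \<in> words b" "run A q (a # u) = Some q" using a t(1) by auto
        then show False using not_circuit unfolding on_circuit_def by blast
      qed
      moreover have "{r. reachable b A t r} \<subseteq> {r. reachable b A q r}"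
        using reachable_trans[OF reachable_delta[OF t(1) a]] by (intro Collect_mono) simp
      moreover have "q \<in> {r. reachable b A q r}" by simp
      ultimately have "{r. reachable b A t r} \<subset> {r. reachable b A q r}" by blast
      moreover have "{r. reachable b A q r} \<subseteq> states A"
        using reachableD[OF _ q] by (intro subsetI) simp
      then have "finite {r. reachable b A q r}" by (rule finite_subset) (use dfa in \<open>simp add: dfa_def\<close>)
      ultimately have "card {r. reachable b A t r} < card {r. reachable b A q r}"
        by (simp add: psubset_card_mono)
      then show "ultimately_periodic (Delta b (L q) a)"
        using less.hyps[of t] deltaD(3)[OF t(1)] t(2) by simp
    qed
  next
    case 2
    then obtain D r where r: "type_one b A D" "r \<in> D" "\<forall>n>0. n \<in> L q \<longleftrightarrow> n \<in> L r"
      using type_two_label[OF assms(2,3) 2 C(2)] by blast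
    then obtain p where "p > 0" "periodic p (L r)" using type_one_periodic[OF assms(1) r(1,2)] by blast
    \<comment> \<open>The threshold is 1, since the two labels may differ at
      \<open>0\<close>.\<close>
    then have "\<forall>n\<ge>1. n + p \<in> L q \<longleftrightarrow> n \<in> L q" using r(3) by (simp add: periodic_def)
    then show ?thesis unfolding ultimately_periodic_iff using \<open>p > 0\<close> by blast
  next
    case 3
    then obtain p where "p > 0" "periodic p (L q)" using type_one_periodic[OF assms(1) 3 C(2)] by blast
    then show ?thesis unfolding ultimately_periodic_iff periodic_def by blast
  qed
qed

end

text \<open>Acceptance of the expansion of \<open>n\<close> without leading zeros, read from the
  least significant digit. The clause \<open>b \<le> 1\<close> leaves only bases for which
  \<open>n div b\<close> is smaller than \<open>n\<close>.\<close>

fun accepts :: "nat \<Rightarrow> 's automaton \<Rightarrow> 's \<Rightarrow> nat \<Rightarrow> bool" where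
  "accepts b A q n = (if n = 0 \<or> b \<le> 1 then q \<in> finals A
     else accepts b A (the (delta A q (n mod b))) (n div b))"

declare accepts.simps [simp del]

lemma accepts_0: "accepts b A q 0 \<longleftrightarrow> q \<in> finals A"
  by (subst accepts.simps) simp

lemma accepts_step:
  "b > 1 \<Longrightarrow> n > 0 \<Longrightarrow> accepts b A q n \<longleftrightarrow> accepts b A (the (delta A q (n mod b))) (n div b)"
  by (subst accepts.simps) simp

text \<open>Condition \<open>UP0\<close> enters where the digit \<open>0\<close> is read and the
  remaining value is \<open>0\<close>: finality must then be unchanged.\<close>

lemma labelled_dfa_accepts:
  assumes "b > 1" "dfa b A" "complete_automaton b A" "UP0 A"
  shows "labelled_dfa b A (\<lambda>q. {n. accepts b A q n})"
proof
  fix q a assume q: "q \<in> states A" and a: "a < b"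
  then obtain r where r: "delta A q a = Some r" using assms(3) by (auto simp: complete_automaton_def)
  have "accepts b A r n \<longleftrightarrow> accepts b A q (n * b + a)" for n
  proof (cases "n * b + a = 0")
    case True
    then have "n = 0" "a = 0" using \<open>b > 1\<close> by auto
    then show ?thesis using assms(4) q r by (simp add: UP0_def accepts_0)
  next
    case False
    have "(n * b + a) mod b = a" "(n * b + a) div b = n" using a by auto
    then show ?thesis using accepts_step[of b "n * b + a" A q] False r \<open>b > 1\<close> by simp
  qed
  then have "{n. accepts b A r n} = Delta b {n. accepts b A q n} a" by (simp add: Delta_def)
  with r show "\<exists>r. delta A q a = Some r \<and> {n. accepts b A r n} = Delta b {n. accepts b A q n} a"
    by blast
qed (use assms in \<open>simp_all add: accepts_0\<close>)

lemma in_UP_if_conditions: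
  assumes "b > 1" "dfa b A" and UP: "UP0 A" "UP1 b A" "UP2 b A" "UP3 b A" "UP4 b A"
  shows "in_UP b A"
proof -
  have min: "minimal_automaton b A" "complete_automaton b A" using UP(2) by (auto simp: UP1_def)
  interpret labelled_dfa b A "\<lambda>q. {n. accepts b A q n}"
    using labelled_dfa_accepts assms(1,2) min(2) UP(1) .
  show ?thesis
    unfolding in_UP_def
    using isomorphic_U_automaton[OF minimalD[OF min(1)]]
      ultimately_periodic_label[OF UP(3-5) initial_state] by (intro exI conjI)
qed

section \<open>Necessity of the conditions\<close>

lemma ultimately_periodic_Delta:
  assumes "b > 0" "ultimately_periodic X"
  shows "ultimately_periodic (Delta b X a)"
proof -
  obtain p N where p: "p > 0" and N: "\<forall>n\<ge>N. n + p \<in> X \<longleftrightarrow> n \<in> X"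
    using assms(2) unfolding ultimately_periodic_iff by blast
  have "n + p \<in> Delta b X a \<longleftrightarrow> n \<in> Delta b X a" if "n \<ge> N" for n
  proof -
    have "n * 1 \<le> n * b" using \<open>b > 0\<close> by (intro mult_le_mono2) simp
    then have "N \<le> n * b + a" using that by linarith
    then have "n * b + a + p * b \<in> X \<longleftrightarrow> n * b + a \<in> X"
      by (rule eventually_periodic_mult[OF N])
    moreover have "(n + p) * b + a = n * b + a + p * b" by (simp add: algebra_simps)
    ultimately show ?thesis by (simp only: Delta_iff)
  qed
  then show ?thesis unfolding ultimately_periodic_iff using p by blast
qed

lemma ultimately_periodic_Delta_word:
  "b > 0 \<Longrightarrow> ultimately_periodic X \<Longrightarrow> ultimately_periodic (Delta_word b X u)"
  by (induction u arbitrary: X) (simp_all add: ultimately_periodic_Delta)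

text \<open>In a one-state component the transition is a loop, and a type-two circuit carries only
  zeros, so neither other kind is possible.\<close>

lemma type_oneI:
  assumes C: "C \<in> sccs b A" and pq: "p \<in> C" "q \<in> C" "delta A p a = Some q" and a: "0 < a" "a < b"
  shows "type_one b A C"
  unfolding type_one_def
proof (intro conjI)
  show "\<not> trivial_scc b A C"
  proof
    assume "trivial_scc b A C"
    then obtain r where r: "C = {r}" "\<not> on_circuit b A r" unfolding trivial_scc_def by blast
    then have "[a] \<in> words b" "run A r [a] = Some r" using pq a by auto
    then have "on_circuit b A r" unfolding on_circuit_def by (intro bexI[of _ "[a]"]) simp_all
    then show False using r(2) by simp
  qed
  show "\<not> type_two b A C"
  proof
    assume "type_two b A C"
    moreover have "(p, a, q) \<in> internal_transitions A C"
      using pq by (simp add: internal_transitions_def)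
    ultimately show False using a by (auto simp: type_two_def)
  qed
qed (rule C)

text \<open>The intermediate state \<open>p\<close> leads to \<open>r\<close> and from there back to
  \<open>q\<close>. This lets inductions on runs within \<open>C\<close> peel off the first
  letter.\<close>

lemma sccs_run_closed:
  assumes "dfa b A" and C: "C \<in> sccs b A" "q \<in> C" "r \<in> C"
    and "delta A q a = Some p" "run A p u = Some r" "a < b" "u \<in> words b"
  shows "p \<in> C"
proof (rule sccs_memI[OF C(1,2)])
  show "p \<in> states A" using assms(1,5) unfolding dfa_def by blast
  show "reachable b A q p" using assms(5,7) by (rule reachable_delta)
  have "reachable b A p r" using assms(6,8) by (auto simp: reachable_def)
  then show "reachable b A p q" using sccs_reachable[OF C(1,3,2)] by (rule reachable_trans)
qed

text \<open>A nontrivial component with only internal transitions labelled \<open>0\<close> is a simple circuit: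
  it is the orbit of any of its states under the digit \<open>0\<close>.\<close>

lemma type_one_positive_transition:
  assumes "dfa b A" and one: "type_one b A C"
  shows "\<exists>p\<in>C. \<exists>q\<in>C. \<exists>a. 0 < a \<and> delta A p a = Some q"
proof (rule ccontr)
  assume no: "\<not> ?thesis"
  have C: "C \<in> sccs b A" and nontriv: "\<not> trivial_scc b A C" and "\<not> type_two b A C"
    using one by (auto simp: type_one_def)
  have zero: "a = 0" if "p \<in> C" "q \<in> C" "delta A p a = Some q" for p q a
  proof (rule ccontr)
    assume "a \<noteq> 0"
    then have "0 < a" by simp
    then show False using no that by blast
  qed
  obtain q0 where q0: "q0 \<in> C" using sccs_nonempty[OF C] by blast
  have run_zero: "u = replicate (length u) 0" if "run A q u = Some r" "q \<in> C" "r \<in> C" "u \<in> words b" for q r u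
    using that
  proof (induction u arbitrary: q)
    case (Cons a u)
    then obtain p where p: "delta A q a = Some p" "run A p u = Some r"
      by (auto simp: bind_eq_Some_conv)
    have "p \<in> C" using sccs_run_closed[OF assms(1) C Cons.prems(2,3) p] Cons.prems(4) by simp
    then show ?case using Cons.IH[OF p(2)] zero[OF Cons.prems(2) _ p(1)] Cons.prems by simp
  qed simp
  define s where "s i = the (run A q0 (replicate i 0))" for i
  obtain u where u: "u \<in> words b" "u \<noteq> []" "run A q0 u = Some q0"
    using nontrivial_on_circuit[OF C nontriv q0] unfolding on_circuit_def by blast
  have circuit: "run A q0 (replicate (length u) 0) = Some q0"
    using run_zero[OF u(3) q0 q0 u(1)] u(3) by simp
  \<comment> \<open>The least positive return time to \<open>q0\<close> is the length of the
    circuit; its minimality makes the states \<open>s i\<close> distinct.\<close>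
  define k where "k = (LEAST k. k > 0 \<and> run A q0 (replicate k 0) = Some q0)"
  have k: "k > 0" "run A q0 (replicate k 0) = Some q0"
    using LeastI[of "\<lambda>k. k > 0 \<and> run A q0 (replicate k 0) = Some q0" "length u"] u(2) circuit
    by (simp_all add: k_def)
  have k_least: "k \<le> j" if "j > 0" "run A q0 (replicate j 0) = Some q0" for j
    unfolding k_def by (rule Least_le) (use that in simp)
  have run_add: "run A q0 (replicate (i + j) 0) =
      Option.bind (run A q0 (replicate i 0)) (\<lambda>r. run A r (replicate j 0))" for i j
    by (simp add: replicate_add run_append)
  have run_mult: "run A q0 (replicate (k * j) 0) = Some q0" for j
    by (induction j) (use k(2) run_add in \<open>simp_all\<close>)
  have run_mod: "run A q0 (replicate i 0) = run A q0 (replicate (i mod k) 0)" for i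
    using run_add[of "k * (i div k)" "i mod k"] run_mult[of "i div k"] by simp
  \<comment> \<open>No bound on \<open>b\<close> is assumed here, so \<open>0 < b\<close> is
    extracted from the circuit word, which is nonempty and consists of zeros.\<close>
  have zeros: "replicate i 0 \<in> words b" for i
  proof -
    have "0 \<in> set u" using run_zero[OF u(3) q0 q0 u(1)] u(2)
      by (metis length_greater_0_conv in_set_replicate length_0_conv)
    then have "0 < b" using u(1) by (auto simp: words_def)
    then show ?thesis by (auto simp: words_def)
  qed
  have s_run: "run A q0 (replicate i 0) = Some (s i) \<and> s i \<in> C" if "i < k" for i
  proof -
    have "Option.bind (run A q0 (replicate i 0)) (\<lambda>r. run A r (replicate (k - i) 0)) = Some q0"
      using run_add[of i "k - i"] k(2) that by simp
    then obtain r where r: "run A q0 (replicate i 0) = Some r" "run A r (replicate (k - i) 0) = Some q0"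
      by (auto simp: bind_eq_Some_conv)
    have "r \<in> states A"
      using r(1) sccsD(1)[OF C q0]
    proof (induction i arbitrary: r)
      case (Suc i)
      then show ?case using \<open>dfa b A\<close> unfolding replicate_Suc
        by (auto simp: dfa_def bind_eq_Some_conv run_append simp flip: replicate_append_same)
    qed simp
    moreover have "reachable b A q0 r" "reachable b A r q0"
      using r zeros unfolding reachable_def by blast+
    ultimately show ?thesis using sccs_memI[OF C q0] r(1) by (simp add: s_def)
  qed
  have s_step: "delta A (s i) 0 = Some (s (Suc i mod k))" if "i < k" for i
  proof -
    have "run A q0 (replicate (Suc i) 0) = Some (s (Suc i mod k))"
      using run_mod[of "Suc i"] s_run[of "Suc i mod k"] k(1) by simp
    moreover have "run A q0 (replicate (Suc i) 0) = Option.bind (Some (s i)) (\<lambda>r. run A r [0])"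
      using run_add[of i 1] s_run[OF that] by (metis One_nat_def add_Suc_right add_0_right
          replicate_0 replicate_Suc)
    ultimately show ?thesis by (cases "delta A (s i) 0") simp_all
  qed
  have "inj_on s {..<k}"
  proof (rule linorder_inj_onI')
    fix i j assume ij: "i \<in> {..<k}" "j \<in> {..<k}" "i < j"
    show "s i \<noteq> s j"
    proof
      assume "s i = s j"
      then have "run A q0 (replicate i 0) = run A q0 (replicate j 0)" using s_run ij by simp
      \<comment> \<open>The \<open>k - j\<close> zeros that close the circuit from
        \<open>s j\<close> would also close it from \<open>s i\<close>, giving a return after fewer
        than \<open>k\<close> steps.\<close>
      then have "run A q0 (replicate (i + (k - j)) 0) = run A q0 (replicate (j + (k - j)) 0)"
        by (simp only: run_add)
      also have "\<dots> = Some q0" using k(2) ij by simp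
      finally have "k \<le> i + (k - j)" using k_least ij by simp
      then show False using ij by simp
    qed
  qed
  moreover have "C = s ` {..<k}"
  proof (intro equalityI subsetI)
    fix r assume r: "r \<in> C"
    then obtain v where v: "v \<in> words b" "run A q0 v = Some r"
      using sccs_reachable[OF C q0] unfolding reachable_def by blast
    then have "run A q0 (replicate (length v mod k) 0) = Some r"
      using run_zero[OF v(2) q0 r v(1)] run_mod[of "length v"] by simp
    then have "r = s (length v mod k)" by (simp add: s_def)
    then show "r \<in> s ` {..<k}" using k(1) by simp
  qed (use s_run in auto)
  moreover have "internal_transitions A C = {(s i, 0, s (Suc i mod k)) | i. i < k}"
  proof (intro equalityI subsetI)
    fix x assume "x \<in> internal_transitions A C"
    then obtain p a q where x: "x = (p, a, q)" "p \<in> C" "q \<in> C" "delta A p a = Some q"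
      by (auto simp: internal_transitions_def)
    have "a = 0" using zero x by blast
    moreover obtain i where "i < k" "p = s i" using x(2) \<open>C = s ` {..<k}\<close> by auto
    ultimately show "x \<in> {(s i, 0, s (Suc i mod k)) | i. i < k}" using s_step x by auto
  next
    fix x assume "x \<in> {(s i, 0 :: nat, s (Suc i mod k)) | i. i < k}"
    then obtain i where "i < k" "x = (s i, 0, s (Suc i mod k))" by blast
    then show "x \<in> internal_transitions A C"
      using s_step s_run[of i] s_run[of "Suc i mod k"] k(1) by (simp add: internal_transitions_def)
  qed
  ultimately have "type_two b A C"
    unfolding type_two_def using C nontriv k(1) by (intro conjI exI[of _ k] exI[of _ s]) simp_all
  then show False using \<open>\<not> type_two b A C\<close> by simp
qed

text \<open>Exactly the data extracted from membership in the class: \<open>L\<close> is an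
  isomorphism onto \<open>U_automaton b (L (initial A))\<close>.\<close>

locale UP_dfa = labelled_dfa +
  assumes inj: "inj_on L (states A)"
    and reach: "\<And>q. q \<in> states A \<Longrightarrow> reachable b A (initial A) q"
    and up_initial: "ultimately_periodic (L (initial A))"
begin

lemma states_eqI: "p \<in> states A \<Longrightarrow> q \<in> states A \<Longrightarrow> L p = L q \<Longrightarrow> p = q"
  using inj by (auto dest: inj_onD)

lemma up_label:
  assumes "q \<in> states A"
  shows "ultimately_periodic (L q)"
proof -
  obtain u where "run A (initial A) u = Some q" using reach[OF assms] by (auto simp: reachable_def)
  then have "L q = Delta_word b (L (initial A)) u" using runD initial_state by blast
  then show ?thesis using ultimately_periodic_Delta_word up_initial base by simp
qed

text \<open>Reading \<open>u\<close> fixes the label of \<open>q\<close>, which is therefore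
  invariant under the affine map given by the length and value of \<open>u\<close>.\<close>

lemma circuit_periodic:
  assumes q: "q \<in> states A" and u: "run A q u = Some q" "u \<noteq> []"
  shows "\<exists>p>0. coprime p b \<and> (\<forall>n. n > 0 \<or> val b u > 0 \<longrightarrow> (n + p \<in> L q \<longleftrightarrow> n \<in> L q))"
proof (rule affine_invariant_periodic[OF up_label[OF q]])
  have "L q = Delta_word b (L q) u" using runD[OF u(1) q] by simp
  then show "n * b ^ length u + val b u \<in> L q \<longleftrightarrow> n \<in> L q" for n
    using Delta_word_iff[of n b "L q" u] by simp
  show "b > 1" by (rule base)
  show "length u > 0" using u(2) by simp
qed blast

text \<open>Any coprime shift may serve as witness; \<open>coprime_period\<close> passes to the
  least one when atomicity is derived.\<close>

definition pure :: "'a \<Rightarrow> bool" where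
  "pure q \<longleftrightarrow> q \<in> states A \<and> (\<exists>p>0. coprime p b \<and> periodic p (L q))"

lemma pure_reachable_back:
  assumes "pure q" "reachable b A q r"
  shows "reachable b A r q"
  using assms reachable_back[OF inj] unfolding pure_def by blast

text \<open>Whatever is reachable from a pure state leads back to it, so its component has no
  exit.\<close>

lemma pure_scc_closed:
  assumes "pure q" "r \<in> scc_of b A q" "delta A r a = Some t"
  shows "t \<in> scc_of b A q"
proof -
  have "reachable b A q t"
    using assms(2) reachable_delta[OF assms(3) deltaD(2)[OF assms(3)]]
    by (auto simp: scc_of_def intro: reachable_trans)
  then show ?thesis
    using pure_reachable_back[OF assms(1)] deltaD(3)[OF assms(3)] by (simp add: scc_of_def)
qed

lemma pure_scc_type_one:
  assumes "pure q"
  shows "type_one b A (scc_of b A q)"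
proof -
  have q: "q \<in> states A" using assms by (simp add: pure_def)
  obtain t where t: "delta A q 1 = Some t" using step[OF q base] by blast
  show ?thesis
    using type_oneI[OF scc_of_in_sccs[OF q] self_in_scc_of[OF q] _ t _ base]
      pure_scc_closed[OF assms self_in_scc_of[OF q] t] by simp
qed

text \<open>A component without exit is complete as an automaton and keeps the labels
  \<open>L\<close>, so it is the automaton of the periodic set \<open>L q\<close>.\<close>

lemma pure_atomic:
  assumes "pure q"
  shows "UP_atomic b (restrict_automaton A (scc_of b A q) q)"
proof -
  let ?C = "scc_of b A q" and ?R = "restrict_automaton A (scc_of b A q) q"
  have q: "q \<in> states A" using assms by (simp add: pure_def)
  have sub: "?C \<subseteq> states A" by (auto simp: scc_of_def)
  have R: "states ?R = ?C" "initial ?R = q" "finals ?R = finals A \<inter> ?C"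
    by (simp_all add: restrict_automaton_def)
  interpret R: labelled_dfa b ?R L
  proof
    show "dfa b ?R" using dfa_restrict[OF dfa sub self_in_scc_of[OF q]] .
    fix r a assume r: "r \<in> states ?R" "a < b"
    then have "r \<in> ?C" "r \<in> states A" using R sub by auto
    then obtain t where t: "delta A r a = Some t" "L t = Delta b (L r) a" using step[OF _ r(2)] by blast
    then show "\<exists>t. delta ?R r a = Some t \<and> L t = Delta b (L r) a"
      using pure_scc_closed[OF assms \<open>r \<in> ?C\<close> t(1)] \<open>r \<in> ?C\<close> by (simp add: delta_restrict)
  next
    fix r assume "r \<in> states ?R"
    then show "r \<in> finals ?R \<longleftrightarrow> 0 \<in> L r" using final_iff[of r] sub R by auto
  qed (rule base)
  have run_eq: "run ?R p u = Some r" if "run A p u = Some r" "p \<in> ?C" for p u r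
    using that
  proof (induction u arbitrary: p)
    case (Cons a u)
    then obtain t where t: "delta A p a = Some t" "run A t u = Some r"
      by (auto simp: bind_eq_Some_conv)
    then have "t \<in> ?C" using pure_scc_closed[OF assms Cons.prems(2)] by blast
    then have "delta ?R p a = Some t" using t(1) Cons.prems(2) by (simp add: delta_restrict)
    then show ?case using Cons.IH[OF t(2) \<open>t \<in> ?C\<close>] by simp
  qed simp
  have "reachable b ?R (initial ?R) r" if "r \<in> states ?R" for r
  proof -
    have "reachable b A q r" using that R(1) by (simp add: scc_of_def)
    then obtain u where u: "u \<in> words b" "run A q u = Some r" by (auto simp: reachable_def)
    then have "run ?R q u = Some r" using run_eq self_in_scc_of[OF q] by blast
    then show ?thesis unfolding reachable_def R(2) using u(1) by blast
  qed
  moreover have "inj_on L (states ?R)" using inj sub R(1) by (simp add: inj_on_subset)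
  ultimately have "isomorphic b ?R (U_automaton b (L q))"
    using R.isomorphic_U_automaton R(2) by simp
  moreover have "purely_periodic (L q) \<and> coprime (period (L q)) b"
    using assms coprime_period unfolding pure_def by blast
  ultimately show ?thesis unfolding UP_atomic_def by blast
qed

text \<open>A positive internal letter lies on a circuit of positive value, for which
  \<open>circuit_periodic\<close> makes no exception at \<open>0\<close>.\<close>

lemma UP2: "UP2 b A"
  unfolding UP2_def
proof (intro allI impI)
  fix C assume one: "type_one b A C"
  then have C: "C \<in> sccs b A" by (simp add: type_one_def)
  obtain q r a where qr: "q \<in> C" "r \<in> C" "0 < a" "delta A q a = Some r"
    using type_one_positive_transition[OF dfa one] by blast
  obtain u where "u \<in> words b" "run A r u = Some q"
    using sccs_reachable[OF C qr(2,1)] by (auto simp: reachable_def)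
  then have u: "run A q (a # u) = Some q" "val b (a # u) > 0" using qr(3,4) by simp_all
  have q: "q \<in> states A" using sccsD(1)[OF C qr(1)] .
  obtain p where "p > 0" "coprime p b" "\<forall>n. n + p \<in> L q \<longleftrightarrow> n \<in> L q"
    using circuit_periodic[OF q u(1)] u(2) by auto
  then have "pure q" using q by (auto simp: pure_def periodic_def)
  then have "UP_atomic b (restrict_automaton A C q)"
    using pure_atomic sccsD(2)[OF C qr(1)] by simp
  then show "UP_atomic_scc b A C" using C qr(1) by (auto simp: UP_atomic_scc_def)
qed

lemma type_two_zero:
  assumes "type_two b A C" "q \<in> C"
  shows "\<exists>r\<in>C. delta A q 0 = Some r" "\<And>a r. r \<in> C \<Longrightarrow> delta A q a = Some r \<Longrightarrow> a = 0"
proof -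
  obtain k s where k: "k \<ge> 1" and C: "C = s ` {..<k}"
    and int: "internal_transitions A C = {(s i, 0, s (Suc i mod k)) | i. i < k}"
    using assms(1) unfolding type_two_def by (elim conjE exE) (rule that)
  obtain i where i: "i < k" "q = s i" using assms(2) C by auto
  have "(q, 0, s (Suc i mod k)) \<in> internal_transitions A C" unfolding int using i by blast
  then show "\<exists>r\<in>C. delta A q 0 = Some r" by (auto simp: internal_transitions_def)
  fix a r assume "r \<in> C" "delta A q a = Some r"
  then have "(q, a, r) \<in> internal_transitions A C" using assms(2) by (simp add: internal_transitions_def)
  then show "a = 0" unfolding int by blast
qed

text \<open>On a circuit labelled by zeros the label is periodic except at \<open>0\<close>. It cannot be periodic
  at \<open>0\<close> too, since then the transition by the digit \<open>1\<close> would be internal.\<close>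

lemma type_two_companion:
  assumes two: "type_two b A C" and "q \<in> C"
  shows "\<exists>t. pure t \<and> L t = sym_diff (L q) {0}"
proof -
  have C: "C \<in> sccs b A" "\<not> trivial_scc b A C" using two by (auto simp: type_two_def)
  have q: "q \<in> states A" using sccsD(1)[OF C(1) \<open>q \<in> C\<close>] .
  obtain u where u: "u \<in> words b" "u \<noteq> []" "run A q u = Some q"
    using nontrivial_on_circuit[OF C \<open>q \<in> C\<close>] unfolding on_circuit_def by blast
  obtain p where p: "p > 0" "coprime p b"
    and p_period: "\<forall>n. n > 0 \<or> val b u > 0 \<longrightarrow> (n + p \<in> L q \<longleftrightarrow> n \<in> L q)"
    using circuit_periodic[OF q u(3,2)] by (elim exE conjE) (rule that)
  obtain r where r: "delta A q 1 = Some r" using step[OF q base] by blast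
  have "\<not> (p \<in> L q \<longleftrightarrow> 0 \<in> L q)"
  proof
    assume "p \<in> L q \<longleftrightarrow> 0 \<in> L q"
    then have "n + p \<in> L q \<longleftrightarrow> n \<in> L q" for n using p_period[rule_format, of n] by (cases "n = 0") simp_all
    then have "pure q" using p(1,2) q by (auto simp: pure_def periodic_def)
    then have "r \<in> C"
      using pure_scc_closed[OF _ self_in_scc_of[OF q] r] sccsD(2)[OF C(1) \<open>q \<in> C\<close>] by simp
    then show False using type_two_zero(2)[OF two \<open>q \<in> C\<close> _ r] by simp
  qed
  then have per: "periodic p (sym_diff (L q) {0})"
    unfolding periodic_def
  proof (intro allI)
    fix n
    show "n + p \<in> sym_diff (L q) {0} \<longleftrightarrow> n \<in> sym_diff (L q) {0}"
      using p_period[rule_format, of n] \<open>\<not> (p \<in> L q \<longleftrightarrow> 0 \<in> L q)\<close> p(1) by (cases "n = 0") auto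
  qed
  \<comment> \<open>The digit 1 cannot detect the toggling, since \<open>n * b + 1\<close> is never
    \<open>0\<close>. So the toggled set is reached from the label of \<open>r\<close> by a return
    word, and is itself the label of a state.\<close>
  have "L r = Delta b (sym_diff (L q) {0}) 1" using deltaD(4)[OF r] by (auto simp: Delta_def)
  then obtain w where w: "w \<in> words b" "Delta_word b (L r) w = sym_diff (L q) {0}"
    using Delta_return[OF p(1,2) per base] by auto
  have r_state: "r \<in> states A" using deltaD(3)[OF r] .
  obtain t where t: "run A r w = Some t" using run_ex[OF r_state w(1)] by blast
  then have "t \<in> states A" "L t = sym_diff (L q) {0}" using runD[OF t r_state] w(2) by auto
  then show ?thesis using p(1,2) per unfolding pure_def by (intro exI[of _ t]) auto
qed

text \<open>Let \<open>f q\<close> be the state whose label is that of \<open>q\<close> with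
  \<open>0\<close> toggled. Toggling commutes with the digit \<open>0\<close> and is invisible to
  positive digits, so \<open>f\<close> respects internal transitions and identifies the exits from
  \<open>C\<close> with transitions inside the component \<open>D\<close> of the images.\<close>

lemma type_two_structure:
  assumes two: "type_two b A C"
  shows "\<exists>D. {X. descendant b A X C} = {D} \<and> type_one b A D \<and> embedded b A C D"
proof -
  have C: "C \<in> sccs b A" using two by (simp add: type_two_def)
  have C_states: "q \<in> states A" if "q \<in> C" for q using sccsD(1)[OF C that] .
  obtain f where f: "\<And>q. q \<in> C \<Longrightarrow> pure (f q) \<and> L (f q) = sym_diff (L q) {0}"
    using type_two_companion[OF two] by metis
  have f_state: "f q \<in> states A" if "q \<in> C" for q using f[OF that] by (simp add: pure_def)
  have f_zero: "delta A (f q) 0 = Some (f r)" 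
    if qr: "q \<in> C" "r \<in> C" "delta A q 0 = Some r" for q r
  proof -
    have "0 < b" using base by simp
    then obtain t where t: "delta A (f q) 0 = Some t" "L t = Delta b (L (f q)) 0"
      using step[OF f_state[OF qr(1)]] by blast
    \<comment> \<open>As \<open>n * b = 0\<close> holds only for \<open>n = 0\<close>, toggling
      \<open>0\<close> commutes with reading \<open>0\<close>.\<close>
    have "L t = L (f r)"
      using t(2) f[OF qr(1)] f[OF qr(2)] deltaD(4)[OF qr(3)] \<open>0 < b\<close> by (auto simp: Delta_def)
    then have "t = f r" using states_eqI deltaD(3)[OF t(1)] f_state[OF qr(2)] by blast
    then show ?thesis using t(1) by simp
  qed
  have f_pos: "delta A (f q) a = delta A q a" if q: "q \<in> C" "0 < a" "a < b" for q a
  proof -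
    obtain r t where r: "delta A q a = Some r" "L r = Delta b (L q) a"
      and t: "delta A (f q) a = Some t" "L t = Delta b (L (f q)) a"
      using step[OF C_states[OF q(1)] q(3)] step[OF f_state[OF q(1)] q(3)] by blast
    \<comment> \<open>As \<open>n * b + a\<close> is positive, the toggled number \<open>0\<close>
      is never consulted.\<close>
    have "L t = L r" using r(2) t(2) f[OF q(1)] q(2) by (auto simp: Delta_def)
    then have "t = r" using states_eqI deltaD(3)[OF t(1)] deltaD(3)[OF r(1)] by blast
    then show ?thesis using r(1) t(1) by simp
  qed
  have f_run: "run A (f q) u = Some (f r)"
    if "run A q u = Some r" "q \<in> C" "r \<in> C" "u \<in> words b" for q u r
    using that
  proof (induction u arbitrary: q)
    case (Cons a u)
    then obtain p where p: "delta A q a = Some p" "run A p u = Some r"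
      by (auto simp: bind_eq_Some_conv)
    have pC: "p \<in> C" using sccs_run_closed[OF dfa C Cons.prems(2,3) p] Cons.prems(4) by simp
    then have "a = 0" using type_two_zero(2)[OF two Cons.prems(2) _ p(1)] by simp
    then show ?case using f_zero[OF Cons.prems(2) pC] p Cons.IH[OF p(2) pC] Cons.prems by simp
  qed simp
  obtain q0 where q0: "q0 \<in> C" using sccs_nonempty[OF C] by blast
  define D where "D = scc_of b A (f q0)"
  have pure0: "pure (f q0)" using f[OF q0] by simp
  have D: "D \<in> sccs b A" "type_one b A D"
    using scc_of_in_sccs[OF f_state[OF q0]] pure_scc_type_one[OF pure0] by (simp_all add: D_def)
  have CD: "C \<noteq> D" using two D(2) by (auto simp: type_one_def)
  then have disj: "q \<notin> D" if "q \<in> C" for q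
    using that sccsD(2)[OF C] sccsD(2)[OF D(1)] by metis
  have D_states: "q \<in> states A" if "q \<in> D" for q using sccsD(1)[OF D(1) that] .
  have closed: "t \<in> D" if "r \<in> D" "delta A r a = Some t" for r a t
    using pure_scc_closed[OF pure0] that by (simp add: D_def)
  have fD: "f q \<in> D" if q: "q \<in> C" for q
  proof -
    obtain u where "u \<in> words b" "run A q0 u = Some q"
      using sccs_reachable[OF C q0 q] by (auto simp: reachable_def)
    then have "reachable b A (f q0) (f q)"
      using f_run q0 q unfolding reachable_def by blast
    then show ?thesis
      using pure_reachable_back[OF pure0] f_state[OF q] by (simp add: D_def scc_of_def)
  qed
  have leave: "t \<in> D" if q: "q \<in> C" "delta A q a = Some t" "t \<notin> C" for q a t
  proof -
    \<comment> \<open>The successor by \<open>0\<close> stays in \<open>C\<close>, so an exit has a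
      positive digit and is shared with \<open>f q\<close>, which lies in the closed component
      \<open>D\<close>.\<close>
    obtain r where r: "r \<in> C" "delta A q 0 = Some r" using type_two_zero(1)[OF two q(1)] by blast
    then have "0 < a" using q by (cases "a = 0") auto
    then have "delta A (f q) a = Some t" using f_pos[OF q(1) _ deltaD(2)[OF q(2)]] q(2) by simp
    then show ?thesis by (rule closed[OF fD[OF q(1)]])
  qed
  have "{X. descendant b A X C} = {D}"
  proof (intro equalityI subsetI)
    fix X assume "X \<in> {X. descendant b A X C}"
    then obtain y x a where X: "X \<in> sccs b A" "C \<noteq> X" and yx: "y \<in> C" "x \<in> X" "delta A y a = Some x"
      by (auto simp: descendant_def component_graph_def)
    have "x \<notin> C" using X yx(2) sccsD(2)[OF C] sccsD(2)[OF X(1)] by metis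
    then have "x \<in> D" using leave yx by blast
    then have "X = D" using yx(2) sccsD(2)[OF X(1)] sccsD(2)[OF D(1)] by metis
    then show "X \<in> {D}" by simp
  next
    fix X assume "X \<in> {D}"
    \<comment> \<open>The digit 1 always leaves \<open>C\<close>, which shows that \<open>D\<close>
      really is a descendant.\<close>
    obtain t where t: "delta A q0 1 = Some t" using step[OF C_states[OF q0] base] by blast
    have "t \<in> D" using closed[OF fD[OF q0], of 1] f_pos[OF q0 _ base] t by simp
    then have "(C, 1, D) \<in> component_graph b A"
      using C D(1) CD base q0 t by (auto simp: component_graph_def)
    then show "X \<in> {X. descendant b A X C}" using \<open>X \<in> {D}\<close> by (auto simp: descendant_def)
  qed
  moreover have "embedded b A C D"
    unfolding embedded_def
  proof (intro conjI C D(1) CD bexI)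
    \<comment> \<open>The companion map on \<open>C\<close>, extended by the identity on
      \<open>D\<close>; \<open>C\<close> and \<open>D\<close> are disjoint.\<close>
    let ?F = "\<lambda>s. if s \<in> D then s else f s"
    show "?F \<in> C \<union> D \<rightarrow> D" using fD by auto
    show "\<forall>s\<in>D. ?F s = s" by simp
    show "\<forall>s\<in>C. \<forall>a<b. delta A s a \<noteq> None \<longleftrightarrow> delta A (?F s) a \<noteq> None"
    proof (intro ballI allI impI)
      fix s a assume "s \<in> C" "a < b"
      then show "delta A s a \<noteq> None \<longleftrightarrow> delta A (?F s) a \<noteq> None"
        using step[OF C_states, of s a] step[OF f_state, of s a] disj by auto
    qed
    show "\<forall>s\<in>C \<union> D. \<forall>a<b. \<forall>t\<in>C \<union> D. delta A s a = Some t \<longrightarrow> delta A (?F s) a = Some (?F t)"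
    proof (intro ballI allI impI)
      fix s a t assume s: "s \<in> C \<union> D" and a: "a < b" and t: "t \<in> C \<union> D" "delta A s a = Some t"
      show "delta A (?F s) a = Some (?F t)"
      proof (cases "s \<in> D")
        case True
        then show ?thesis using closed[OF True t(2)] t(2) by simp
      next
        case False
        then have sC: "s \<in> C" using s by simp
        show ?thesis
        proof (cases "t \<in> C")
          case True
          then have "a = 0" using type_two_zero(2)[OF two sC _ t(2)] by simp
          then show ?thesis using f_zero[OF sC True] t(2) disj[OF True] False by simp
        next
          case tC: False
          then have "0 < a" using type_two_zero(1)[OF two sC] t(2) by (cases "a = 0") auto
          then show ?thesis using f_pos[OF sC _ a] t tC False by simp
        qed
      qed
    qed
  qed
  ultimately show ?thesis using D(2) by blast
qed

lemma conditions: "UP0 A \<and> UP1 b A \<and> UP2 b A \<and> UP3 b A \<and> UP4 b A"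
proof (intro conjI UP2)
  show "UP0 A"
    unfolding UP0_def
  proof (intro ballI allI impI)
    fix q r assume q: "q \<in> states A" and r: "delta A q 0 = Some r"
    show "q \<in> finals A \<longleftrightarrow> r \<in> finals A"
      using final_iff[OF q] final_iff[OF deltaD(3)[OF r]] deltaD(4)[OF r] by simp
  qed
  show "UP1 b A" using minimal[OF inj reach] complete by (simp add: UP1_def)
  show "UP3 b A" unfolding UP3_def
  proof (intro allI impI)
    fix C assume "type_two b A C"
    from type_two_structure[OF this]
    show "\<exists>D. {X. descendant b A X C} = {D} \<and> type_one b A D" by blast
  qed
  show "UP4 b A" unfolding UP4_def
  proof (intro allI impI)
    fix C D assume CD: "type_two b A C \<and> descendant b A D C"
    then obtain D' where "{X. descendant b A X C} = {D'}" "embedded b A C D'"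
      using type_two_structure[of C] by auto
    moreover have "D \<in> {X. descendant b A X C}" using CD by simp
    ultimately show "embedded b A C D" by simp
  qed
qed

end

theorem theorem4p3:
  fixes b :: nat and A :: "'s automaton"
  assumes "b > 1" and "dfa b A"
  shows "in_UP b A \<longleftrightarrow> UP0 A \<and> UP1 b A \<and> UP2 b A \<and> UP3 b A \<and> UP4 b A"
proof
  assume "in_UP b A"
  then obtain S where S: "ultimately_periodic S" "isomorphic b A (U_automaton b S)"
    by (auto simp: in_UP_def)
  obtain L where L: "labelled_dfa b A L" "inj_on L (states A)" "L (initial A) = S"
    "\<And>q. q \<in> states A \<Longrightarrow> reachable b A (initial A) q"
    by (rule isomorphic_U_automatonD[OF assms S(2)]) (rule that)
  then have "UP_dfa b A L" using S(1) by (simp add: UP_dfa_def UP_dfa_axioms_def)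
  then show "UP0 A \<and> UP1 b A \<and> UP2 b A \<and> UP3 b A \<and> UP4 b A" by (rule UP_dfa.conditions)
next
  assume "UP0 A \<and> UP1 b A \<and> UP2 b A \<and> UP3 b A \<and> UP4 b A"
  then show "in_UP b A" using in_UP_if_conditions[OF assms] by blast
qed

end
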